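(* A complete list of $G^{\rm ess}$-inequivalent one-dimensional subalgebras of $\mathfrak g^{\rm ess}$ is exhausted by the subalgebras $$\mathfrak s_{1.1}=\langle\mathcal P^t+\mathcal P^3\rangle,\quad \mathfrak s_{1.2}^\delta=\langle\mathcal P^t+\delta\mathcal I\rangle,\quad \mathfrak s_{1.3}^\nu=\langle\mathcal D+\nu\mathcal I\rangle,\quad \mathfrak s_{1.4}^\mu=\langle\mathcal P^t+\mathcal K+\mu\mathcal I\rangle,$$ $$\mathfrak s_{1.5}^\varepsilon=\langle\mathcal P^2+\varepsilon\mathcal P^0\rangle,\quad \mathfrak s_{1.6}=\langle\mathcal P^1\rangle,\quad \mathfrak s_{1.7}=\langle\mathcal P^0\rangle,\quad \mathfrak s_{1.8}=\langle\mathcal I\rangle,$$ where $\varepsilon\in\{-1,1\}$, $\delta\in\{-1,0,1\}$, and $\mu$ and $\nu$ are arbitrary real constants with $\nu\geqslant0$.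
   Context: Consider the equation $u_t+xu_y=u_{xx}$ for real $u=u(t,x,y)$. Its essential Lie invariance algebra is the eight-dimensional real Lie algebra $\mathfrak g^{\rm ess}=\langle\mathcal P^t,\mathcal D,\mathcal K,\mathcal P^3,\mathcal P^2,\mathcal P^1,\mathcal P^0,\mathcal I\rangle$ of vector fields on $\mathbb R^4_{t,x,y,u}$, with the usual Lie bracket of vector fields, where $\mathcal P^t=\partial_t$, $\mathcal D=2t\partial_t+x\partial_x+3y\partial_y-2u\partial_u$, $\mathcal K=t^2\partial_t+(tx+3y)\partial_x+3ty\partial_y-(x^2+2t)u\partial_u$, $\mathcal P^3=3t^2\partial_x+t^3\partial_y+3(y-tx)u\partial_u$, $\mathcal P^2=2t\partial_x+t^2\partial_y-xu\partial_u$, $\mathcal P^1=\partial_x+t\partial_y$, $\mathcal P^0=\partial_y$, $\mathcal I=u\partial_u$. Angle brackets denote linear span over $\mathbb R$. The essential point symmetry group $G^{\rm ess}$ of the equation consists of the transformations $$\tilde t=\frac{\alpha t+\beta}{\gamma t+\delta},\quad \tilde x=\frac{\hat x}{\gamma t+\delta}-\frac{3\gamma\hat y}{(\gamma t+\delta)^2},\quad \tilde y=\frac{\hat y}{(\gamma t+\delta)^3},$$ $$\tilde u=\sigma(\gamma t+\delta)^2\exp\left(\frac{\gamma\hat x^2}{\gamma t+\delta}-\frac{3\gamma^2\hat x\hat y}{(\gamma t+\delta)^2}+\frac{3\gamma^3\hat y^2}{(\gamma t+\delta)^3}\right)\exp\bigl(3\lambda_3(y-tx)-\lambda_2x-(3\lambda_3^2t^3+3\lambda_3\lambda_2t^2+\lambda_2^2t)\bigr)u,$$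 where $\hat x:=x+3\lambda_3t^2+2\lambda_2t+\lambda_1$, $\hat y:=y+\lambda_3t^3+\lambda_2t^2+\lambda_1t+\lambda_0$, and $\alpha,\beta,\gamma,\delta,\lambda_0,\dots,\lambda_3,\sigma$ are arbitrary real constants with $\alpha\delta-\beta\gamma=1$, $\sigma\neq0$ (here $\delta$ is a group parameter, unrelated to the $\delta$ in the list of subalgebras). The domain of each is $\{\gamma t+\delta\ne0\}$, and the group operation is composition extended by continuity to the natural domain of the resulting transformation. The group $G^{\rm ess}$ acts on $\mathfrak g^{\rm ess}$ by pushforwards of vector fields. Two subalgebras of $\mathfrak g^{\rm ess}$ are $G^{\rm ess}$-equivalent if one is the pushforward of the other by an element of $G^{\rm ess}$. A complete list of $G^{\rm ess}$-inequivalent subalgebras of a given dimension contains exactly one representative of each equivalence class. *)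

theory Defs
  imports "HOL-Analysis.Analysis" "HOL-Library.Function_Algebras"
begin

instantiation "fun" :: (type, real_vector) real_vector
begin

definition scaleR_fun :: "real \<Rightarrow> ('a \<Rightarrow> 'b) \<Rightarrow> 'a \<Rightarrow> 'b" where
  "scaleR_fun c f = (\<lambda>x. c *\<^sub>R f x)"

instance
  by standard
    (simp_all add: scaleR_fun_def plus_fun_def fun_eq_iff scaleR_add_right scaleR_add_left)

end

text \<open>Points of $\mathbb{R}^4$ are tuples \<open>(t, x, y, u)\<close>. A vector field
  $a\partial_t + b\partial_x + c\partial_y + d\partial_u$ is the map sending each point to its
  coefficient tuple \<open>(a, b, c, d)\<close>.\<close>

type_synonym point = "real \<times> real \<times> real \<times> real"
type_synonym vfield = "point \<Rightarrow> point"

definition lie_bracket :: "vfield \<Rightarrow> vfield \<Rightarrow> vfield" where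
  "lie_bracket X Y = (\<lambda>p. frechet_derivative Y (at p) (X p) - frechet_derivative X (at p) (Y p))"

definition vPt :: vfield where "vPt = (\<lambda>(t, x, y, u). (1, 0, 0, 0))"
definition vD :: vfield where "vD = (\<lambda>(t, x, y, u). (2 * t, x, 3 * y, - 2 * u))"
definition vK :: vfield where
  "vK = (\<lambda>(t, x, y, u). (t\<^sup>2, t * x + 3 * y, 3 * t * y, - (x\<^sup>2 + 2 * t) * u))"
definition vP3 :: vfield where
  "vP3 = (\<lambda>(t, x, y, u). (0, 3 * t\<^sup>2, t ^ 3, 3 * (y - t * x) * u))"
definition vP2 :: vfield where "vP2 = (\<lambda>(t, x, y, u). (0, 2 * t, t\<^sup>2, - x * u))"
definition vP1 :: vfield where "vP1 = (\<lambda>(t, x, y, u). (0, 1, t, 0))"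
definition vP0 :: vfield where "vP0 = (\<lambda>(t, x, y, u). (0, 0, 1, 0))"
definition vI :: vfield where "vI = (\<lambda>(t, x, y, u). (0, 0, 0, u))"

definition g_ess :: "vfield set" where
  "g_ess = span {vPt, vD, vK, vP3, vP2, vP1, vP0, vI}"

definition subalgebra :: "vfield set \<Rightarrow> bool" where
  "subalgebra S \<longleftrightarrow> S \<subseteq> g_ess \<and> subspace S \<and> (\<forall>X\<in>S. \<forall>Y\<in>S. lie_bracket X Y \<in> S)"

text \<open>A transformation is undefined where \<open>\<gamma> t + \<delta>\<close> vanishes. The arguments \<open>l0\<close>, ..., \<open>l3\<close>
  are the parameters $\lambda_0, \dots, \lambda_3$.\<close>

definition point_transf ::
  "real \<Rightarrow> real \<Rightarrow> real \<Rightarrow> real \<Rightarrow> real \<Rightarrow> real \<Rightarrow> real \<Rightarrow> real \<Rightarrow> real \<Rightarrow> point \<rightharpoonup> point" where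
  "point_transf \<alpha> \<beta> \<gamma> \<delta> l0 l1 l2 l3 \<sigma> = (\<lambda>(t, x, y, u).
     let s = \<gamma> * t + \<delta>;
         xh = x + 3 * l3 * t\<^sup>2 + 2 * l2 * t + l1;
         yh = y + l3 * t ^ 3 + l2 * t\<^sup>2 + l1 * t + l0
     in if s = 0 then None
        else Some
          ((\<alpha> * t + \<beta>) / s,
           xh / s - 3 * \<gamma> * yh / s\<^sup>2,
           yh / s ^ 3,
           \<sigma> * s\<^sup>2
             * exp (\<gamma> * xh\<^sup>2 / s - 3 * \<gamma>\<^sup>2 * xh * yh / s\<^sup>2 + 3 * \<gamma> ^ 3 * yh\<^sup>2 / s ^ 3)
             * exp (3 * l3 * (y - t * x) - l2 * x
                    - (3 * l3\<^sup>2 * t ^ 3 + 3 * l3 * l2 * t\<^sup>2 + l2\<^sup>2 * t))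
             * u))"

definition G_ess :: "(point \<rightharpoonup> point) set" where
  "G_ess = {point_transf \<alpha> \<beta> \<gamma> \<delta> l0 l1 l2 l3 \<sigma> | \<alpha> \<beta> \<gamma> \<delta> l0 l1 l2 l3 \<sigma>.
     \<alpha> * \<delta> - \<beta> * \<gamma> = 1 \<and> \<sigma> \<noteq> 0}"

text \<open>\<open>is_pushforward \<Phi> X Y\<close> says that \<open>Y\<close> is the pushforward of \<open>X\<close> under \<open>\<Phi>\<close>. The equation
  determines \<open>Y\<close> on the range of \<open>\<Phi>\<close>. For \<open>\<Phi> \<in> G_ess\<close> this range is dense,
  so a continuous \<open>Y\<close> on the whole space is unique.\<close>

definition is_pushforward :: "(point \<rightharpoonup> point) \<Rightarrow> vfield \<Rightarrow> vfield \<Rightarrow> bool" where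
  "is_pushforward \<Phi> X Y \<longleftrightarrow>
     (\<forall>p\<in>dom \<Phi>. Y (the (\<Phi> p)) = frechet_derivative (\<lambda>q. the (\<Phi> q)) (at p) (X p))"

text \<open>\<open>rel_set (is_pushforward \<Phi>) S S'\<close> says that \<open>S'\<close> consists precisely of the pushforwards
  of the elements of \<open>S\<close>.\<close>

definition G_equivalent :: "vfield set \<Rightarrow> vfield set \<Rightarrow> bool" where
  "G_equivalent S S' \<longleftrightarrow> (\<exists>\<Phi>\<in>G_ess. rel_set (is_pushforward \<Phi>) S S')"

text \<open>A complete list is an indexed family, so that distinct indices must give inequivalent
  (in particular distinct) subalgebras.\<close>

definition complete_list :: "nat \<Rightarrow> 'i set \<Rightarrow> ('i \<Rightarrow> vfield set) \<Rightarrow> bool" where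
  "complete_list n A \<ss> \<longleftrightarrow>
     (\<forall>i\<in>A. subalgebra (\<ss> i) \<and> dim (\<ss> i) = n) \<and>
     (\<forall>S. subalgebra S \<and> dim S = n \<longrightarrow> (\<exists>!i. i \<in> A \<and> G_equivalent S (\<ss> i)))"

datatype label = S1 | S2 real | S3 real | S4 real | S5 real | S6 | S7 | S8

fun listed_subalgebra :: "label \<Rightarrow> vfield set" where
  "listed_subalgebra S1 = span {vPt + vP3}"
| "listed_subalgebra (S2 \<delta>) = span {vPt + \<delta> *\<^sub>R vI}"
| "listed_subalgebra (S3 \<nu>) = span {vD + \<nu> *\<^sub>R vI}"
| "listed_subalgebra (S4 \<mu>) = span {vPt + vK + \<mu> *\<^sub>R vI}"
| "listed_subalgebra (S5 \<epsilon>) = span {vP2 + \<epsilon> *\<^sub>R vP0}"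
| "listed_subalgebra S6 = span {vP1}"
| "listed_subalgebra S7 = span {vP0}"
| "listed_subalgebra S8 = span {vI}"

definition admissible_labels :: "label set" where
  "admissible_labels =
     {S1, S6, S7, S8} \<union> S2 ` {-1, 0, 1} \<union> S3 ` {0..} \<union> range S4 \<union> S5 ` {-1, 1}"

end

theory Submission
  imports Defs
begin

text \<open>Every element of $G^{\rm ess}$ is a Moebius-type transformation after a transformation of the Heisenberg
  part, and each factor acts on $\mathfrak g^{\rm ess}$ in coordinates: on the $\mathfrak{sl}_2$-part
  $(a, b, c)$ as on quadratic forms, on the coefficients of $\mathcal P^3, \dots, \mathcal P^0$ as on binary
  cubics, while $\lambda$ shifts the cubic and the coefficient of $\mathcal I$. So the task is to classify
  nonzero coefficient vectors up to this action and scaling. If the quadratic form is nonzero, it can be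
  brought to one of three shapes by the sign of its discriminant, and shifting by $\lambda$ removes the
  cubic except for one coefficient in the parabolic case. If it vanishes, the coefficient of $\mathcal I$
  can be removed unless the cubic is zero, and real binary cubics are classified by the multiplicities
  of their roots and the sign of their discriminant. The same data separate the normal forms.\<close>

text \<open>The elements of G^ess are partial maps whose composites must be extended by continuity,
  so maps are never composed. The group law is proved for the actions on coefficients instead:
  \<open>ad_M\<close> is multiplicative in the matrix, \<open>ad_H\<close> is additive in \<lambda>,
  and a shift passes through a matrix at the price of transforming \<lambda>. This makes
  \<open>coeff_equiv\<close> an equivalence relation. The passage from maps to coefficients rests on
  one fact: \<open>vf v\<close> is determined by its values on a single fibre t = const, and each
  transformation carries such a fibre in its domain onto another one. A shift changes the cubic by a
  linear map in \<lambda> that depends only on the quadratic form T. If T is nondegenerate, this map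
  is bijective: the cubic can be removed, only \<lambda> = 0 keeps it removed, and the coefficient
  of I survives as a continuous parameter. If T = 1, the map is differentiation. It cannot reach the
  cube of the variable, which explains the extra P^3, and its kernel, the constants, still moves the
  coefficient of I when that cube is present.\<close>

text \<open>The components of a coefficient vector belong to $\mathcal P^t$, $\mathcal D$, $\mathcal K$,
  $\mathcal P^3$, $\mathcal P^2$, $\mathcal P^1$, $\mathcal P^0$, $\mathcal I$, in this order.\<close>

type_synonym coeffs = "real \<times> real \<times> real \<times> real \<times> real \<times> real \<times> real \<times> real"

section \<open>Coefficient vectors and one-dimensional subalgebras\<close>

definition vf :: "coeffs \<Rightarrow> vfield" where
  "vf = (\<lambda>(a, b, c, p3, p2, p1, p0, k).
     a *\<^sub>R vPt + b *\<^sub>R vD + c *\<^sub>R vK + p3 *\<^sub>R vP3 + p2 *\<^sub>R vP2 + p1 *\<^sub>R vP1 + p0 *\<^sub>R vP0 + k *\<^sub>R vI)"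

text \<open>With \<open>T = a + 2 * b * t + c * t^2\<close> and
  \<open>q = p3 * t^3 + p2 * t^2 + p1 * t + p0\<close>, the components are T, (T'/2) x + (3/2) T'' y
  + q', (3/2) T' y + q and (- T' - (T''/2) x^2 + (q'''/2) y - (q''/2) x + k) u. Thus only k and the
  Taylor coefficients of T and q at t enter, which is what the later computations exploit.\<close>

lemma vf_apply:
  "vf (a, b, c, p3, p2, p1, p0, k) (t, x, y, u) =
    (a + 2 * b * t + c * t\<^sup>2,
     b * x + c * (t * x + 3 * y) + 3 * p3 * t\<^sup>2 + 2 * p2 * t + p1,
     3 * b * y + 3 * c * t * y + p3 * t ^ 3 + p2 * t\<^sup>2 + p1 * t + p0,
     (- 2 * b - c * (x\<^sup>2 + 2 * t) + 3 * p3 * (y - t * x) - p2 * x + k) * u)"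
  by (simp add: vf_def plus_fun_def scaleR_fun_def vPt_def vD_def vK_def vP3_def vP2_def vP1_def
      vP0_def vI_def algebra_simps)

lemma linear_vf: "linear vf"
  by (rule linearI) (auto simp: vf_def scaleR_add_left scaleR_add_right)

lemma g_ess_eq_range_vf: "g_ess = range vf"
proof
  show "g_ess \<subseteq> range vf"
  proof
    fix X assume "X \<in> g_ess"
    then obtain a b c p3 p2 p1 p0 k where
      "X - a *\<^sub>R vPt - b *\<^sub>R vD - c *\<^sub>R vK - p3 *\<^sub>R vP3 - p2 *\<^sub>R vP2 - p1 *\<^sub>R vP1 - p0 *\<^sub>R vP0 - k *\<^sub>R vI = 0"
      unfolding g_ess_def by (auto simp: span_insert span_empty)
    then have "X = vf (a, b, c, p3, p2, p1, p0, k)"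
      by (simp add: vf_def algebra_simps)
    then show "X \<in> range vf" by blast
  qed
  show "range vf \<subseteq> g_ess"
    by (auto simp: vf_def g_ess_def intro!: span_add span_scale intro: span_base)
qed

text \<open>For fixed t the components are polynomials in x and y whose coefficients reveal k and
  the Taylor coefficients of both forms at \<tau>. Working on one fibre avoids a density argument
  for the range of a transformation.\<close>

lemma eq_0_if_vf_fibre_0:
  assumes "\<And>x y. vf v (\<tau>, x, y, 1) = 0"
  shows "v = 0"
proof -
  obtain a b c p3 p2 p1 p0 k where v: "v = (a, b, c, p3, p2, p1, p0, k)"
    by (metis surj_pair)
  note 0 = assms[unfolded v vf_apply zero_prod_def prod.inject]
  have c: "c = 0" using 0[of 0 0] 0[of 0 1] 0[of 0 "- 1"] by auto
  have b: "b = 0" using 0[of 0 0] 0[of 1 0] c by auto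
  have a: "a = 0" using 0[of 0 0] b c by auto
  have p3: "p3 = 0" using 0[of 0 0] 0[of 0 1] b c by auto
  have p2: "p2 = 0" using 0[of 0 0] 0[of 1 0] b c p3 by auto
  have "k = 0" using 0[of 0 0] b c p3 p2 by auto
  moreover have "p1 = 0" using 0[of 0 0] b c p3 p2 by auto
  moreover have "p0 = 0" using 0[of 0 0] b c p3 p2 \<open>p1 = 0\<close> by auto
  ultimately show ?thesis
    using a b c p3 p2 by (simp add: v zero_prod_def)
qed

lemma eq_0_if_vf_eq_0: "vf v = 0 \<Longrightarrow> v = 0"
  by (rule eq_0_if_vf_fibre_0) simp

lemma differentiable_vf: "vf v differentiable at p"
proof -
  obtain a b c p3 p2 p1 p0 k where v: "v = (a, b, c, p3, p2, p1, p0, k)"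
    by (metis surj_pair)
  have "vf v = (\<lambda>q.
    (a + 2 * b * fst q + c * (fst q)\<^sup>2,
     b * fst (snd q) + c * (fst q * fst (snd q) + 3 * fst (snd (snd q))) + 3 * p3 * (fst q)\<^sup>2 + 2 * p2 * fst q + p1,
     3 * b * fst (snd (snd q)) + 3 * c * fst q * fst (snd (snd q)) + p3 * fst q ^ 3 + p2 * (fst q)\<^sup>2 + p1 * fst q + p0,
     (- 2 * b - c * ((fst (snd q))\<^sup>2 + 2 * fst q) + 3 * p3 * (fst (snd (snd q)) - fst q * fst (snd q)) - p2 * fst (snd q) + k)
       * snd (snd (snd q))))"
    by (auto simp: v vf_apply)
  then show ?thesis
    unfolding differentiable_def
    by (auto intro!: exI derivative_eq_intros)
qed

text \<open>All brackets within a line vanish; differentiability of \<open>vf v\<close> is what lets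
  scalars be pulled out of \<open>frechet_derivative\<close>.\<close>

lemma subalgebra_span_vf: "subalgebra (span {vf v})"
proof -
  have "lie_bracket (r *\<^sub>R vf v) (s *\<^sub>R vf v) = 0" for r s
  proof
    fix p
    let ?D = "frechet_derivative (vf v) (at p)"
    have D: "(vf v has_derivative ?D) (at p)"
      using differentiable_vf frechet_derivative_works by blast
    have "frechet_derivative (r *\<^sub>R vf v) (at p) = (\<lambda>h. r *\<^sub>R ?D h)" for r
      unfolding scaleR_fun_def
      by (rule frechet_derivative_at[OF has_derivative_scaleR_right[OF D], symmetric])
    moreover have "?D (r *\<^sub>R h) = r *\<^sub>R ?D h" for r h
      using linear_scale[OF has_derivative_linear[OF D]] .
    ultimately show "lie_bracket (r *\<^sub>R vf v) (s *\<^sub>R vf v) p = 0 p"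
      by (simp add: lie_bracket_def scaleR_fun_def mult.commute)
  qed
  moreover have "span {vf v} \<subseteq> g_ess"
    unfolding g_ess_eq_range_vf
    by (auto simp: span_singleton linear_scale[OF linear_vf, symmetric])
  ultimately show ?thesis
    by (auto simp: subalgebra_def subspace_span) (auto simp: span_singleton intro!: exI[of _ 0])
qed

lemma dim_span_vf:
  assumes "v \<noteq> 0"
  shows "dim (span {vf v}) = 1"
proof -
  have "vf v \<noteq> 0"
    using assms eq_0_if_vf_eq_0 by blast
  then show ?thesis
    by (simp add: dim_eq_card_independent[of "{vf v}"])
qed

lemma one_dim_subalgebra_cases:
  assumes "subalgebra S" "dim S = 1"
  obtains v where "v \<noteq> 0" "S = span {vf v}"
proof -
  obtain B where B: "B \<subseteq> S" "independent B" "S \<subseteq> span B" "card B = 1"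
    using basis_exists[of S] assms(2) by metis
  then obtain X where X: "B = {X}"
    by (auto simp: card_1_singleton_iff)
  have "X \<in> range vf"
    using B X assms(1) by (auto simp: subalgebra_def g_ess_eq_range_vf)
  then obtain v where v: "X = vf v" by blast
  have "X \<noteq> 0"
    using B(2) X dependent_zero by auto
  then have "v \<noteq> 0"
    using v linear_0[OF linear_vf] by auto
  moreover have "span B \<subseteq> S"
    using B(1) assms(1) by (simp add: span_minimal subalgebra_def)
  ultimately show thesis
    using that B X v by blast
qed

text \<open>With \<open>T \<tau> = a + 2 * b * \<tau> + c * \<tau>\<^sup>2\<close> and \<open>q \<tau> = p3 * \<tau> ^ 3 + p2 * \<tau>\<^sup>2 + p1 * \<tau> + p0\<close>, the result of
  \<open>ad_M\<close> belongs to the forms \<open>(\<alpha> - \<gamma> * \<tau>)\<^sup>2 * T \<tau>'\<close> and \<open>(\<alpha> - \<gamma> * \<tau>) ^ 3 * q \<tau>'\<close>, where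
  \<open>\<tau>' = (\<delta> * \<tau> - \<beta>) / (\<alpha> - \<gamma> * \<tau>)\<close>. For \<open>L \<tau> = l3 * \<tau> ^ 3 + l2 * \<tau>\<^sup>2 + l1 * \<tau> + l0\<close>, the cubic of \<open>ad_H\<close>
  is \<open>q + L' * T - (3 / 2) * L * T'\<close>, with primes for derivatives.\<close>

fun ad_M :: "real \<Rightarrow> real \<Rightarrow> real \<Rightarrow> real \<Rightarrow> coeffs \<Rightarrow> coeffs" where
  "ad_M \<alpha> \<beta> \<gamma> \<delta> (a, b, c, p3, p2, p1, p0, k) =
    (a * \<alpha>\<^sup>2 - 2 * b * \<alpha> * \<beta> + c * \<beta>\<^sup>2,
     - a * \<alpha> * \<gamma> + b * (\<alpha> * \<delta> + \<beta> * \<gamma>) - c * \<beta> * \<delta>,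
     a * \<gamma>\<^sup>2 - 2 * b * \<gamma> * \<delta> + c * \<delta>\<^sup>2,
     p3 * \<delta> ^ 3 - p2 * \<delta>\<^sup>2 * \<gamma> + p1 * \<delta> * \<gamma>\<^sup>2 - p0 * \<gamma> ^ 3,
     - 3 * p3 * \<delta>\<^sup>2 * \<beta> + p2 * (\<delta>\<^sup>2 * \<alpha> + 2 * \<delta> * \<beta> * \<gamma>) - p1 * (\<beta> * \<gamma>\<^sup>2 + 2 * \<delta> * \<alpha> * \<gamma>) + 3 * p0 * \<alpha> * \<gamma>\<^sup>2,
     3 * p3 * \<delta> * \<beta>\<^sup>2 - p2 * (2 * \<delta> * \<beta> * \<alpha> + \<beta>\<^sup>2 * \<gamma>) + p1 * (\<delta> * \<alpha>\<^sup>2 + 2 * \<beta> * \<alpha> * \<gamma>) - 3 * p0 * \<alpha>\<^sup>2 * \<gamma>,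
     - p3 * \<beta> ^ 3 + p2 * \<beta>\<^sup>2 * \<alpha> - p1 * \<beta> * \<alpha>\<^sup>2 + p0 * \<alpha> ^ 3,
     k)"

fun ad_H :: "real \<Rightarrow> real \<Rightarrow> real \<Rightarrow> real \<Rightarrow> coeffs \<Rightarrow> coeffs" where
  "ad_H l0 l1 l2 l3 (a, b, c, p3, p2, p1, p0, k) =
    (a, b, c,
     p3 + 3 * b * l3 - c * l2,
     p2 + 3 * a * l3 + b * l2 - 2 * c * l1,
     p1 + 2 * a * l2 - b * l1 - 3 * c * l0,
     p0 + a * l1 - 3 * b * l0,
     k - c * l1\<^sup>2 - 3 * p3 * l0 + p2 * l1 + a * (3 * l3 * l1 - l2\<^sup>2) - l2 * (p1 - b * l1 - 3 * c * l0)
       + 3 * l3 * (p0 - 3 * b * l0))"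

section \<open>The two factors of a transformation and their differentials\<close>

text \<open>Total for convenience: where \<gamma> t + \<delta> vanishes, division yields 0 and the
  value carries no meaning.\<close>

definition map_M :: "real \<Rightarrow> real \<Rightarrow> real \<Rightarrow> real \<Rightarrow> real \<Rightarrow> point \<Rightarrow> point" where
  "map_M \<alpha> \<beta> \<gamma> \<delta> \<sigma> = (\<lambda>(t, x, y, u). let s = \<gamma> * t + \<delta> in
     ((\<alpha> * t + \<beta>) / s, x / s - 3 * \<gamma> * y / s\<^sup>2, y / s ^ 3,
      \<sigma> * s\<^sup>2 * exp (\<gamma> * x\<^sup>2 / s - 3 * \<gamma>\<^sup>2 * x * y / s\<^sup>2 + 3 * \<gamma> ^ 3 * y\<^sup>2 / s ^ 3) * u))"

definition map_H :: "real \<Rightarrow> real \<Rightarrow> real \<Rightarrow> real \<Rightarrow> point \<Rightarrow> point" where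
  "map_H l0 l1 l2 l3 = (\<lambda>(t, x, y, u).
     (t, x + 3 * l3 * t\<^sup>2 + 2 * l2 * t + l1, y + l3 * t ^ 3 + l2 * t\<^sup>2 + l1 * t + l0,
      exp (3 * l3 * (y - t * x) - l2 * x - (3 * l3\<^sup>2 * t ^ 3 + 3 * l3 * l2 * t\<^sup>2 + l2\<^sup>2 * t)) * u))"

lemma point_transf_eq:
  "point_transf \<alpha> \<beta> \<gamma> \<delta> l0 l1 l2 l3 \<sigma> p =
    (if \<gamma> * fst p + \<delta> = 0 then None else Some (map_M \<alpha> \<beta> \<gamma> \<delta> \<sigma> (map_H l0 l1 l2 l3 p)))"
  by (cases p) (simp add: point_transf_def map_M_def map_H_def Let_def)

lemma fst_map_H: "fst (map_H l0 l1 l2 l3 p) = fst p"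
  by (cases p) (simp add: map_H_def)

text \<open>Both u-components are \<open>e * u\<close> times a polynomial, so the exponential drops
  out and polynomial identities remain.\<close>

lemma map_H_derivative:
  "\<exists>D. (map_H l0 l1 l2 l3 has_derivative D) (at p) \<and>
     D (vf v p) = vf (ad_H l0 l1 l2 l3 v) (map_H l0 l1 l2 l3 p)"
proof -
  obtain a b c p3 p2 p1 p0 k where v: "v = (a, b, c, p3, p2, p1, p0, k)"
    by (metis surj_pair)
  obtain t x y u where p: "p = (t, x, y, u)"
    by (metis surj_pair)
  define e where "e = exp (3 * l3 * (y - t * x) - l2 * x - (3 * l3\<^sup>2 * t ^ 3 + 3 * l3 * l2 * t\<^sup>2 + l2\<^sup>2 * t))"
  let ?D = "\<lambda>h. (fst h, fst (snd h) + 6 * l3 * t * fst h + 2 * l2 * fst h,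
      fst (snd (snd h)) + 3 * l3 * t\<^sup>2 * fst h + 2 * l2 * t * fst h + l1 * fst h,
      e * (snd (snd (snd h)) + u * (3 * l3 * (fst (snd (snd h)) - t * fst (snd h) - x * fst h) - l2 * fst (snd h)
        - (9 * l3\<^sup>2 * t\<^sup>2 + 6 * l3 * l2 * t + l2\<^sup>2) * fst h)))"
  have eq: "map_H l0 l1 l2 l3 = (\<lambda>q. (fst q, fst (snd q) + 3 * l3 * (fst q)\<^sup>2 + 2 * l2 * fst q + l1,
      fst (snd (snd q)) + l3 * fst q ^ 3 + l2 * (fst q)\<^sup>2 + l1 * fst q + l0,
      exp (3 * l3 * (fst (snd (snd q)) - fst q * fst (snd q)) - l2 * fst (snd q)
        - (3 * l3\<^sup>2 * fst q ^ 3 + 3 * l3 * l2 * (fst q)\<^sup>2 + l2\<^sup>2 * fst q)) * snd (snd (snd q))))"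
    by (auto simp: map_H_def)
  have "(map_H l0 l1 l2 l3 has_derivative ?D) (at p)"
    unfolding eq p e_def
    by (rule has_derivative_Pair | auto intro!: derivative_eq_intros simp: fun_eq_iff power2_eq_square power3_eq_cube algebra_simps)+
  moreover have "?D (vf v p) = vf (ad_H l0 l1 l2 l3 v) (map_H l0 l1 l2 l3 p)"
    unfolding v p map_H_def
    by (simp add: vf_apply e_def[symmetric]) (simp add: power2_eq_square power3_eq_cube algebra_simps)
  ultimately show ?thesis by blast
qed

text \<open>Writing \<open>r\<close> for the inverse of \<open>s\<close> turns every component into
  a polynomial identity modulo \<open>s * r = 1\<close> and the determinant condition.\<close>

lemma map_M_derivative:
  assumes "\<alpha> * \<delta> - \<beta> * \<gamma> = 1" "\<gamma> * fst p + \<delta> \<noteq> 0"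
  shows "\<exists>D. (map_M \<alpha> \<beta> \<gamma> \<delta> \<sigma> has_derivative D) (at p) \<and>
     D (vf v p) = vf (ad_M \<alpha> \<beta> \<gamma> \<delta> v) (map_M \<alpha> \<beta> \<gamma> \<delta> \<sigma> p)"
proof -
  obtain a b c p3 p2 p1 p0 k where v: "v = (a, b, c, p3, p2, p1, p0, k)"
    by (metis surj_pair)
  obtain t x y u where p: "p = (t, x, y, u)"
    by (metis surj_pair)
  define s where "s = \<gamma> * t + \<delta>"
  define r where "r = inverse s"
  have s: "\<gamma> * t + \<delta> \<noteq> 0" using assms(2) p by simp
  have sr: "s * r = 1" "r * s = 1" using s by (simp_all add: r_def s_def)
  define Q where "Q = \<gamma> * x\<^sup>2 * r - 3 * \<gamma>\<^sup>2 * x * y * r\<^sup>2 + 3 * \<gamma> ^ 3 * y\<^sup>2 * r ^ 3"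
  define e where "e = exp Q"
  let ?D = "\<lambda>h::point. (r\<^sup>2 * fst h,
      r * fst (snd h) - 3 * \<gamma> * r\<^sup>2 * fst (snd (snd h)) + (- x * r\<^sup>2 * \<gamma> + 6 * \<gamma>\<^sup>2 * y * r ^ 3) * fst h,
      r ^ 3 * fst (snd (snd h)) - 3 * y * r ^ 4 * \<gamma> * fst h,
      \<sigma> * s\<^sup>2 * e * (snd (snd (snd h)) + u * (
        (2 * \<gamma> * r - \<gamma>\<^sup>2 * x\<^sup>2 * r\<^sup>2 + 6 * \<gamma> ^ 3 * x * y * r ^ 3 - 9 * \<gamma> ^ 4 * y\<^sup>2 * r ^ 4) * fst h
        + (2 * \<gamma> * x * r - 3 * \<gamma>\<^sup>2 * y * r\<^sup>2) * fst (snd h)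
        + (- 3 * \<gamma>\<^sup>2 * x * r\<^sup>2 + 6 * \<gamma> ^ 3 * y * r ^ 3) * fst (snd (snd h)))))"
  have eq: "map_M \<alpha> \<beta> \<gamma> \<delta> \<sigma> = (\<lambda>q. ((\<alpha> * fst q + \<beta>) * inverse (\<gamma> * fst q + \<delta>),
      fst (snd q) * inverse (\<gamma> * fst q + \<delta>) - 3 * \<gamma> * fst (snd (snd q)) * inverse (\<gamma> * fst q + \<delta>) ^ 2,
      fst (snd (snd q)) * inverse (\<gamma> * fst q + \<delta>) ^ 3,
      \<sigma> * (\<gamma> * fst q + \<delta>)\<^sup>2 * exp (\<gamma> * (fst (snd q))\<^sup>2 * inverse (\<gamma> * fst q + \<delta>)
        - 3 * \<gamma>\<^sup>2 * fst (snd q) * fst (snd (snd q)) * inverse (\<gamma> * fst q + \<delta>) ^ 2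
        + 3 * \<gamma> ^ 3 * (fst (snd (snd q)))\<^sup>2 * inverse (\<gamma> * fst q + \<delta>) ^ 3) * snd (snd (snd q))))"
    by (auto simp: map_M_def Let_def divide_inverse power_inverse)
  have "(map_M \<alpha> \<beta> \<gamma> \<delta> \<sigma> has_derivative ?D) (at p)"
  proof -
    have R: "((\<lambda>q. inverse (\<gamma> * fst q + \<delta>)) has_derivative (\<lambda>h. - \<gamma> * r\<^sup>2 * fst h)) (at p)"
      by (rule derivative_eq_intros refl | (simp add: p s; fail))+
        (simp add: p fun_eq_iff s_def[symmetric] r_def[symmetric] power2_eq_square)
    have rp: "inverse (\<gamma> * fst p + \<delta>) = r" by (simp add: p r_def s_def)
    have sp: "\<gamma> * fst p + \<delta> = s" by (simp add: p s_def)
    have ep: "exp (\<gamma> * x\<^sup>2 * r - 3 * \<gamma>\<^sup>2 * x * y * r\<^sup>2 + 3 * \<gamma> ^ 3 * y\<^sup>2 * r ^ 3) = e"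
      by (simp add: e_def Q_def)
    show ?thesis
      unfolding eq
    proof (intro has_derivative_Pair)
      show "((\<lambda>q. (\<alpha> * fst q + \<beta>) * inverse (\<gamma> * fst q + \<delta>)) has_derivative (\<lambda>h. r\<^sup>2 * fst h)) (at p)"
        apply (rule R derivative_eq_intros refl)+
        apply (simp only: rp)
        apply (simp add: p fun_eq_iff)
        using assms(1) sr s_def by algebra
      show "((\<lambda>q. fst (snd q) * inverse (\<gamma> * fst q + \<delta>)
          - 3 * \<gamma> * fst (snd (snd q)) * inverse (\<gamma> * fst q + \<delta>) ^ 2) has_derivative
        (\<lambda>h. r * fst (snd h) - 3 * \<gamma> * r\<^sup>2 * fst (snd (snd h)) + (- x * r\<^sup>2 * \<gamma> + 6 * \<gamma>\<^sup>2 * y * r ^ 3) * fst h)) (at p)"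
        apply (rule R derivative_eq_intros refl)+
        apply (simp only: rp)
        by (simp add: p fun_eq_iff power2_eq_square power3_eq_cube algebra_simps)
      show "((\<lambda>q. fst (snd (snd q)) * inverse (\<gamma> * fst q + \<delta>) ^ 3) has_derivative
        (\<lambda>h. r ^ 3 * fst (snd (snd h)) - 3 * y * r ^ 4 * \<gamma> * fst h)) (at p)"
        apply (rule R derivative_eq_intros refl)+
        apply (simp only: rp)
        by (simp add: p fun_eq_iff power2_eq_square power3_eq_cube power4_eq_xxxx algebra_simps)
      show "((\<lambda>q. \<sigma> * (\<gamma> * fst q + \<delta>)\<^sup>2 * exp (\<gamma> * (fst (snd q))\<^sup>2 * inverse (\<gamma> * fst q + \<delta>)
          - 3 * \<gamma>\<^sup>2 * fst (snd q) * fst (snd (snd q)) * inverse (\<gamma> * fst q + \<delta>) ^ 2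
          + 3 * \<gamma> ^ 3 * (fst (snd (snd q)))\<^sup>2 * inverse (\<gamma> * fst q + \<delta>) ^ 3) * snd (snd (snd q)))
        has_derivative (\<lambda>h. \<sigma> * s\<^sup>2 * e * (snd (snd (snd h)) + u * (
        (2 * \<gamma> * r - \<gamma>\<^sup>2 * x\<^sup>2 * r\<^sup>2 + 6 * \<gamma> ^ 3 * x * y * r ^ 3 - 9 * \<gamma> ^ 4 * y\<^sup>2 * r ^ 4) * fst h
        + (2 * \<gamma> * x * r - 3 * \<gamma>\<^sup>2 * y * r\<^sup>2) * fst (snd h)
        + (- 3 * \<gamma>\<^sup>2 * x * r\<^sup>2 + 6 * \<gamma> ^ 3 * y * r ^ 3) * fst (snd (snd h)))))) (at p)"
        apply (rule R derivative_eq_intros refl)+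
        apply (simp only: sp r_def[symmetric])
        apply (simp add: p fun_eq_iff ep)
        using sr by algebra
    qed
  qed
  moreover have "?D (vf v p) = vf (ad_M \<alpha> \<beta> \<gamma> \<delta> v) (map_M \<alpha> \<beta> \<gamma> \<delta> \<sigma> p)"
  proof -
    txt \<open>Since \<open>A = r\<close> and \<open>B = t * r\<close>, all covariants at \<open>\<tau>\<close> are polynomials in \<open>r\<close>, \<open>t\<close>, \<open>\<gamma>\<close>.\<close>
    define \<tau> where "\<tau> = (\<alpha> * t + \<beta>) * r"
    define A where "A = \<alpha> - \<gamma> * \<tau>"
    define B where "B = \<delta> * \<tau> - \<beta>"
    have A: "A = r"
      unfolding A_def \<tau>_def using sr assms(1) s_def by algebra
    have B: "B = t * r"
      unfolding B_def \<tau>_def using sr assms(1) s_def by algebra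
    have \<delta>: "\<delta> = s - \<gamma> * t" by (simp add: s_def)
    obtain a' b' c' p3' p2' p1' p0' where ad: "ad_M \<alpha> \<beta> \<gamma> \<delta> v = (a', b', c', p3', p2', p1', p0', k)"
      and eqs: "a' = a * \<alpha>\<^sup>2 - 2 * b * \<alpha> * \<beta> + c * \<beta>\<^sup>2"
        "b' = - a * \<alpha> * \<gamma> + b * (\<alpha> * \<delta> + \<beta> * \<gamma>) - c * \<beta> * \<delta>"
        "c' = a * \<gamma>\<^sup>2 - 2 * b * \<gamma> * \<delta> + c * \<delta>\<^sup>2"
        "p3' = p3 * \<delta> ^ 3 - p2 * \<delta>\<^sup>2 * \<gamma> + p1 * \<delta> * \<gamma>\<^sup>2 - p0 * \<gamma> ^ 3"
        "p2' = - 3 * p3 * \<delta>\<^sup>2 * \<beta> + p2 * (\<delta>\<^sup>2 * \<alpha> + 2 * \<delta> * \<beta> * \<gamma>) - p1 * (\<beta> * \<gamma>\<^sup>2 + 2 * \<delta> * \<alpha> * \<gamma>) + 3 * p0 * \<alpha> * \<gamma>\<^sup>2"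
        "p1' = 3 * p3 * \<delta> * \<beta>\<^sup>2 - p2 * (2 * \<delta> * \<beta> * \<alpha> + \<beta>\<^sup>2 * \<gamma>) + p1 * (\<delta> * \<alpha>\<^sup>2 + 2 * \<beta> * \<alpha> * \<gamma>) - 3 * p0 * \<alpha>\<^sup>2 * \<gamma>"
        "p0' = - p3 * \<beta> ^ 3 + p2 * \<beta>\<^sup>2 * \<alpha> - p1 * \<beta> * \<alpha>\<^sup>2 + p0 * \<alpha> ^ 3"
      by (simp add: v)
    \<comment> \<open>Taylor coefficients at \<tau> of the transformed forms: \<open>T\<close> lists
      the value and half the first and second derivatives of the quadratic, \<open>q\<close> below
      the value, the first derivative, half the second and a sixth of the third derivative of the
      cubic. The new field is built from exactly these.\<close>
    have T: "a' + 2 * b' * \<tau> + c' * \<tau>\<^sup>2 = a * A\<^sup>2 + 2 * b * A * B + c * B\<^sup>2"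
      "b' + c' * \<tau> = - a * \<gamma> * A + b * (\<delta> * A - \<gamma> * B) + c * \<delta> * B"
      "c' = a * \<gamma>\<^sup>2 - 2 * b * \<gamma> * \<delta> + c * \<delta>\<^sup>2"
      unfolding eqs A_def B_def by (rule refl | algebra)+
    have q: "p3' * \<tau> ^ 3 + p2' * \<tau>\<^sup>2 + p1' * \<tau> + p0' = p3 * B ^ 3 + p2 * B\<^sup>2 * A + p1 * B * A\<^sup>2 + p0 * A ^ 3"
      "3 * p3' * \<tau>\<^sup>2 + 2 * p2' * \<tau> + p1' = 3 * p3 * \<delta> * B\<^sup>2 + p2 * (2 * \<delta> * A * B - \<gamma> * B\<^sup>2)
        + p1 * (\<delta> * A\<^sup>2 - 2 * \<gamma> * A * B) - 3 * p0 * \<gamma> * A\<^sup>2"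
      "3 * p3' * \<tau> + p2' = 3 * p3 * \<delta>\<^sup>2 * B + p2 * (\<delta>\<^sup>2 * A - 2 * \<delta> * \<gamma> * B)
        + p1 * (\<gamma>\<^sup>2 * B - 2 * \<gamma> * \<delta> * A) + 3 * p0 * \<gamma>\<^sup>2 * A"
      "p3' = p3 * \<delta> ^ 3 - p2 * \<delta>\<^sup>2 * \<gamma> + p1 * \<delta> * \<gamma>\<^sup>2 - p0 * \<gamma> ^ 3"
      unfolding eqs A_def B_def by (rule refl | algebra)+
    \<comment> \<open>Each remaining \<delta> is paired with a factor \<open>r\<close>, and \<delta>
      * r is expressed by \<open>r\<close>, \<open>t\<close>, \<gamma>. This is why
      \<open>C\<close>, \<open>q2\<close> and \<open>q3\<close> carry powers of \<open>r\<close>;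
      the new x and y supply them.\<close>
    define d where "d = 1 - \<gamma> * t * r"
    have d: "\<delta> * r = d"
      unfolding d_def \<delta> using sr by algebra
    have P: "b' + c' * \<tau> = - a * \<gamma> * r + b * (d - \<gamma> * t * r) + c * t * d"
      unfolding T(2) A B d[symmetric] by algebra
    have C: "c' * r\<^sup>2 = a * \<gamma>\<^sup>2 * r\<^sup>2 - 2 * b * \<gamma> * r * d + c * d\<^sup>2"
      unfolding T(3) d[symmetric] by algebra
    have q0: "p3' * \<tau> ^ 3 + p2' * \<tau>\<^sup>2 + p1' * \<tau> + p0' = (p3 * t ^ 3 + p2 * t\<^sup>2 + p1 * t + p0) * r ^ 3"
      unfolding q(1) A B by algebra
    have q1: "3 * p3' * \<tau>\<^sup>2 + 2 * p2' * \<tau> + p1' = (3 * p3 * t\<^sup>2 + 2 * p2 * t + p1) * d * r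
        - (p2 * t\<^sup>2 + 2 * p1 * t + 3 * p0) * \<gamma> * r\<^sup>2"
      unfolding q(2) A B d[symmetric] by algebra
    have q2: "(3 * p3' * \<tau> + p2') * r = 3 * p3 * d\<^sup>2 * t + p2 * (d\<^sup>2 - 2 * d * \<gamma> * r * t)
        + p1 * (\<gamma>\<^sup>2 * r\<^sup>2 * t - 2 * \<gamma> * d * r) + 3 * p0 * \<gamma>\<^sup>2 * r\<^sup>2"
      unfolding q(3) A B d[symmetric] by algebra
    have q3: "p3' * r ^ 3 = p3 * d ^ 3 - p2 * d\<^sup>2 * \<gamma> * r + p1 * d * \<gamma>\<^sup>2 * r\<^sup>2 - p0 * \<gamma> ^ 3 * r ^ 3"
      unfolding q(4) d[symmetric] by algebra
    have m: "map_M \<alpha> \<beta> \<gamma> \<delta> \<sigma> p = (\<tau>, x * r - 3 * \<gamma> * y * r\<^sup>2, y * r ^ 3, \<sigma> * s\<^sup>2 * e * u)"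
      by (simp add: p map_M_def Let_def \<tau>_def e_def Q_def r_def s_def divide_inverse power_inverse)
    show ?thesis
      unfolding m ad vf_apply
      unfolding v p vf_apply fst_conv snd_conv prod.inject
    proof (intro conjI)
      show "r\<^sup>2 * (a + 2 * b * t + c * t\<^sup>2) = a' + 2 * b' * \<tau> + c' * \<tau>\<^sup>2"
        unfolding T(1) A B by algebra
    next
      show "r * (b * x + c * (t * x + 3 * y) + 3 * p3 * t\<^sup>2 + 2 * p2 * t + p1)
          - 3 * \<gamma> * r\<^sup>2 * (3 * b * y + 3 * c * t * y + p3 * t ^ 3 + p2 * t\<^sup>2 + p1 * t + p0)
          + (- x * r\<^sup>2 * \<gamma> + 6 * \<gamma>\<^sup>2 * y * r ^ 3) * (a + 2 * b * t + c * t\<^sup>2)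
        = b' * (x * r - 3 * \<gamma> * y * r\<^sup>2) + c' * (\<tau> * (x * r - 3 * \<gamma> * y * r\<^sup>2) + 3 * (y * r ^ 3))
          + 3 * p3' * \<tau>\<^sup>2 + 2 * p2' * \<tau> + p1'"
      proof -
        have "b' * (x * r - 3 * \<gamma> * y * r\<^sup>2) + c' * (\<tau> * (x * r - 3 * \<gamma> * y * r\<^sup>2) + 3 * (y * r ^ 3))
          + 3 * p3' * \<tau>\<^sup>2 + 2 * p2' * \<tau> + p1' = (b' + c' * \<tau>) * (x * r - 3 * \<gamma> * y * r\<^sup>2) + 3 * (c' * r\<^sup>2) * (y * r)
          + (3 * p3' * \<tau>\<^sup>2 + 2 * p2' * \<tau> + p1')"
          by algebra
        then show ?thesis
          unfolding P C q1 d_def by algebra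
      qed
    next
      show "r ^ 3 * (3 * b * y + 3 * c * t * y + p3 * t ^ 3 + p2 * t\<^sup>2 + p1 * t + p0)
          - 3 * y * r ^ 4 * \<gamma> * (a + 2 * b * t + c * t\<^sup>2)
        = 3 * b' * (y * r ^ 3) + 3 * c' * \<tau> * (y * r ^ 3) + p3' * \<tau> ^ 3 + p2' * \<tau>\<^sup>2 + p1' * \<tau> + p0'"
      proof -
        have "3 * b' * (y * r ^ 3) + 3 * c' * \<tau> * (y * r ^ 3) + p3' * \<tau> ^ 3 + p2' * \<tau>\<^sup>2 + p1' * \<tau> + p0'
          = 3 * (b' + c' * \<tau>) * (y * r ^ 3) + (p3' * \<tau> ^ 3 + p2' * \<tau>\<^sup>2 + p1' * \<tau> + p0')"
          by algebra
        then show ?thesis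
          unfolding P q0 d_def by algebra
      qed
    next
      have "(- 2 * b - c * (x\<^sup>2 + 2 * t) + 3 * p3 * (y - t * x) - p2 * x + k)
          + ((2 * \<gamma> * r - \<gamma>\<^sup>2 * x\<^sup>2 * r\<^sup>2 + 6 * \<gamma> ^ 3 * x * y * r ^ 3 - 9 * \<gamma> ^ 4 * y\<^sup>2 * r ^ 4) * (a + 2 * b * t + c * t\<^sup>2)
            + (2 * \<gamma> * x * r - 3 * \<gamma>\<^sup>2 * y * r\<^sup>2) * (b * x + c * (t * x + 3 * y) + 3 * p3 * t\<^sup>2 + 2 * p2 * t + p1)
            + (- 3 * \<gamma>\<^sup>2 * x * r\<^sup>2 + 6 * \<gamma> ^ 3 * y * r ^ 3)
              * (3 * b * y + 3 * c * t * y + p3 * t ^ 3 + p2 * t\<^sup>2 + p1 * t + p0))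
        = - 2 * b' - c' * ((x * r - 3 * \<gamma> * y * r\<^sup>2)\<^sup>2 + 2 * \<tau>)
          + 3 * p3' * (y * r ^ 3 - \<tau> * (x * r - 3 * \<gamma> * y * r\<^sup>2)) - p2' * (x * r - 3 * \<gamma> * y * r\<^sup>2) + k"
      proof -
        have "- 2 * b' - c' * ((x * r - 3 * \<gamma> * y * r\<^sup>2)\<^sup>2 + 2 * \<tau>)
          + 3 * p3' * (y * r ^ 3 - \<tau> * (x * r - 3 * \<gamma> * y * r\<^sup>2)) - p2' * (x * r - 3 * \<gamma> * y * r\<^sup>2) + k
          = - 2 * (b' + c' * \<tau>) - (c' * r\<^sup>2) * (x - 3 * \<gamma> * y * r)\<^sup>2 + 3 * (p3' * r ^ 3) * y
            - (3 * p3' * \<tau> + p2') * r * (x - 3 * \<gamma> * y * r) + k"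
          by algebra
        then show ?thesis
          unfolding P C q2 q3 d_def by algebra
      qed
      then show "\<sigma> * s\<^sup>2 * e * ((- 2 * b - c * (x\<^sup>2 + 2 * t) + 3 * p3 * (y - t * x) - p2 * x + k) * u
          + u * ((2 * \<gamma> * r - \<gamma>\<^sup>2 * x\<^sup>2 * r\<^sup>2 + 6 * \<gamma> ^ 3 * x * y * r ^ 3 - 9 * \<gamma> ^ 4 * y\<^sup>2 * r ^ 4) * (a + 2 * b * t + c * t\<^sup>2)
            + (2 * \<gamma> * x * r - 3 * \<gamma>\<^sup>2 * y * r\<^sup>2) * (b * x + c * (t * x + 3 * y) + 3 * p3 * t\<^sup>2 + 2 * p2 * t + p1)
            + (- 3 * \<gamma>\<^sup>2 * x * r\<^sup>2 + 6 * \<gamma> ^ 3 * y * r ^ 3)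
              * (3 * b * y + 3 * c * t * y + p3 * t ^ 3 + p2 * t\<^sup>2 + p1 * t + p0)))
        = (- 2 * b' - c' * ((x * r - 3 * \<gamma> * y * r\<^sup>2)\<^sup>2 + 2 * \<tau>)
          + 3 * p3' * (y * r ^ 3 - \<tau> * (x * r - 3 * \<gamma> * y * r\<^sup>2)) - p2' * (x * r - 3 * \<gamma> * y * r\<^sup>2) + k)
          * (\<sigma> * s\<^sup>2 * e * u)"
        by algebra
    qed
  qed
  ultimately show ?thesis by blast
qed

section \<open>Pushforwards as an action on coefficients\<close>

lemma ad_M_scaleR: "ad_M \<alpha> \<beta> \<gamma> \<delta> (r *\<^sub>R v) = r *\<^sub>R ad_M \<alpha> \<beta> \<gamma> \<delta> v"
  by (cases "(0 :: real, 0 :: real, 0 :: real, 0 :: real, v)" rule: ad_M.cases) (simp add: algebra_simps)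

lemma ad_H_scaleR: "ad_H l0 l1 l2 l3 (r *\<^sub>R v) = r *\<^sub>R ad_H l0 l1 l2 l3 v"
  by (cases "(0 :: real, 0 :: real, 0 :: real, 0 :: real, v)" rule: ad_M.cases) (simp add: algebra_simps)

lemma is_pushforward_ad:
  assumes "\<alpha> * \<delta> - \<beta> * \<gamma> = 1"
  shows "is_pushforward (point_transf \<alpha> \<beta> \<gamma> \<delta> l0 l1 l2 l3 \<sigma>) (vf v) (vf (ad_M \<alpha> \<beta> \<gamma> \<delta> (ad_H l0 l1 l2 l3 v)))"
  unfolding is_pushforward_def
proof
  fix p
  assume "p \<in> dom (point_transf \<alpha> \<beta> \<gamma> \<delta> l0 l1 l2 l3 \<sigma>)"
  then have s: "\<gamma> * fst p + \<delta> \<noteq> 0"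
    by (auto simp: point_transf_eq dom_def split: if_splits)
  let ?H = "map_H l0 l1 l2 l3" and ?M = "map_M \<alpha> \<beta> \<gamma> \<delta> \<sigma>"
  obtain D where D: "(?H has_derivative D) (at p)" "D (vf v p) = vf (ad_H l0 l1 l2 l3 v) (?H p)"
    using map_H_derivative by blast
  obtain E where E: "(?M has_derivative E) (at (?H p))"
    "E (vf (ad_H l0 l1 l2 l3 v) (?H p)) = vf (ad_M \<alpha> \<beta> \<gamma> \<delta> (ad_H l0 l1 l2 l3 v)) (?M (?H p))"
    using map_M_derivative[OF assms, of "?H p"] s fst_map_H by metis
  have "((\<lambda>q. ?M (?H q)) has_derivative (\<lambda>h. E (D h))) (at p)"
    using diff_chain_at[OF D(1) E(1)] by (simp add: o_def)
  moreover have "open {q :: point. \<gamma> * fst q + \<delta> \<noteq> 0}"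
    by (intro open_Collect_neq continuous_intros)
  ultimately have "((\<lambda>q. the (point_transf \<alpha> \<beta> \<gamma> \<delta> l0 l1 l2 l3 \<sigma> q)) has_derivative (\<lambda>h. E (D h))) (at p)"
    by (rule has_derivative_transform_within_open) (use s in \<open>auto simp: point_transf_eq\<close>)
  then show "vf (ad_M \<alpha> \<beta> \<gamma> \<delta> (ad_H l0 l1 l2 l3 v)) (the (point_transf \<alpha> \<beta> \<gamma> \<delta> l0 l1 l2 l3 \<sigma> p)) =
      frechet_derivative (\<lambda>q. the (point_transf \<alpha> \<beta> \<gamma> \<delta> l0 l1 l2 l3 \<sigma> q)) (at p) (vf v p)"
    using frechet_derivative_at D(2) E(2) s by (metis (no_types, lifting) option.sel point_transf_eq)
qed

text \<open>On a fibre the map is triangular: y is recovered first, then x, then u, the last because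
  \<sigma>, \<open>s\<close> and the exponential do not vanish.\<close>

lemma map_M_fibre_surj:
  assumes "\<gamma> * t + \<delta> \<noteq> 0" "\<sigma> \<noteq> 0"
  obtains x y u where "map_M \<alpha> \<beta> \<gamma> \<delta> \<sigma> (t, x, y, u) = ((\<alpha> * t + \<beta>) / (\<gamma> * t + \<delta>), \<xi>, \<eta>, \<omega>)"
proof -
  define s where "s = \<gamma> * t + \<delta>"
  have s: "s \<noteq> 0" using assms(1) s_def by simp
  define y where "y = \<eta> * s ^ 3"
  define x where "x = s * (\<xi> + 3 * \<gamma> * y / s\<^sup>2)"
  define e where "e = exp (\<gamma> * x\<^sup>2 / s - 3 * \<gamma>\<^sup>2 * x * y / s\<^sup>2 + 3 * \<gamma> ^ 3 * y\<^sup>2 / s ^ 3)"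
  have "e \<noteq> 0" by (simp add: e_def)
  have "map_M \<alpha> \<beta> \<gamma> \<delta> \<sigma> (t, x, y, \<omega> / (\<sigma> * s\<^sup>2 * e)) = ((\<alpha> * t + \<beta>) / (\<gamma> * t + \<delta>), \<xi>, \<eta>, \<omega>)"
    unfolding map_M_def prod.case s_def[symmetric] Let_def e_def[symmetric]
    using s \<open>e \<noteq> 0\<close> assms(2) by (simp add: x_def y_def)
  then show thesis by (rule that)
qed

lemma map_H_fibre_surj:
  obtains x y u where "map_H l0 l1 l2 l3 (t, x, y, u) = (t, \<xi>, \<eta>, \<omega>)"
proof -
  define x where "x = \<xi> - (3 * l3 * t\<^sup>2 + 2 * l2 * t + l1)"
  define y where "y = \<eta> - (l3 * t ^ 3 + l2 * t\<^sup>2 + l1 * t + l0)"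
  define e where "e = exp (3 * l3 * (y - t * x) - l2 * x - (3 * l3\<^sup>2 * t ^ 3 + 3 * l3 * l2 * t\<^sup>2 + l2\<^sup>2 * t))"
  have "e \<noteq> 0" by (simp add: e_def)
  have "map_H l0 l1 l2 l3 (t, x, y, \<omega> / e) = (t, \<xi>, \<eta>, \<omega>)"
    unfolding map_H_def prod.case e_def[symmetric]
    using \<open>e \<noteq> 0\<close> by (simp add: x_def y_def)
  then show thesis by (rule that)
qed

text \<open>Uniqueness: \<gamma> and \<delta> are not both zero, so some t is admissible. Its fibre
  is mapped onto an entire fibre, where the pushforward equation prescribes the values, and these
  determine the coefficients.\<close>

lemma is_pushforward_vf_iff:
  assumes det: "\<alpha> * \<delta> - \<beta> * \<gamma> = 1" and "\<sigma> \<noteq> 0"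
  shows "is_pushforward (point_transf \<alpha> \<beta> \<gamma> \<delta> l0 l1 l2 l3 \<sigma>) (vf v) (vf w) \<longleftrightarrow>
    w = ad_M \<alpha> \<beta> \<gamma> \<delta> (ad_H l0 l1 l2 l3 v)" (is "is_pushforward ?\<Phi> _ _ \<longleftrightarrow> w = ?w")
proof
  assume P: "is_pushforward ?\<Phi> (vf v) (vf w)"
  obtain t where t: "\<gamma> * t + \<delta> \<noteq> 0"
    using det by (metis add.left_neutral add.right_neutral diff_0_right mult.right_neutral
        mult_zero_right zero_neq_one)
  have "vf (w - ?w) ((\<alpha> * t + \<beta>) / (\<gamma> * t + \<delta>), \<xi>, \<eta>, 1) = 0" for \<xi> \<eta>
  proof -
    obtain x y u where 1: "map_M \<alpha> \<beta> \<gamma> \<delta> \<sigma> (t, x, y, u) = ((\<alpha> * t + \<beta>) / (\<gamma> * t + \<delta>), \<xi>, \<eta>, 1)"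
      using map_M_fibre_surj[OF t \<open>\<sigma> \<noteq> 0\<close>] .
    obtain x' y' u' where 2: "map_H l0 l1 l2 l3 (t, x', y', u') = (t, x, y, u)"
      using map_H_fibre_surj .
    have 3: "?\<Phi> (t, x', y', u') = Some ((\<alpha> * t + \<beta>) / (\<gamma> * t + \<delta>), \<xi>, \<eta>, 1)"
      using t by (simp add: point_transf_eq 1 2)
    then have "vf w ((\<alpha> * t + \<beta>) / (\<gamma> * t + \<delta>), \<xi>, \<eta>, 1) = vf ?w ((\<alpha> * t + \<beta>) / (\<gamma> * t + \<delta>), \<xi>, \<eta>, 1)"
      using P is_pushforward_ad[OF det, of l0 l1 l2 l3 \<sigma> v]
      unfolding is_pushforward_def by (metis domI option.sel)
    then show ?thesis
      by (simp add: linear_diff[OF linear_vf])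
  qed
  then show "w = ?w"
    using eq_0_if_vf_fibre_0 by (metis right_minus_eq)
qed (simp add: is_pushforward_ad[OF det])

section \<open>Equivalence of coefficient vectors\<close>

text \<open>The factor \<open>r\<close> reflects that a line determines its generator only up to a
  nonzero scalar. There is no \<sigma>, since scaling u leaves every field of the algebra
  unchanged.\<close>

definition coeff_equiv :: "coeffs \<Rightarrow> coeffs \<Rightarrow> bool" where
  "coeff_equiv v w \<longleftrightarrow> (\<exists>\<alpha> \<beta> \<gamma> \<delta> l0 l1 l2 l3 r. \<alpha> * \<delta> - \<beta> * \<gamma> = 1 \<and> r \<noteq> 0 \<and>
     w = r *\<^sub>R ad_M \<alpha> \<beta> \<gamma> \<delta> (ad_H l0 l1 l2 l3 v))"

text \<open>A generator of the target line comes from some multiple of \<open>vf v\<close>, and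
  \<open>w \<noteq> 0\<close> makes that multiple nonzero. In the converse, \<sigma> = 1 serves
  because \<sigma> does not affect coefficients.\<close>

lemma G_equivalent_span_iff:
  assumes "w \<noteq> 0"
  shows "G_equivalent (span {vf v}) (span {vf w}) \<longleftrightarrow> coeff_equiv v w"
proof
  assume "G_equivalent (span {vf v}) (span {vf w})"
  then obtain \<alpha> \<beta> \<gamma> \<delta> l0 l1 l2 l3 \<sigma> where *: "\<alpha> * \<delta> - \<beta> * \<gamma> = 1" "\<sigma> \<noteq> 0"
    "rel_set (is_pushforward (point_transf \<alpha> \<beta> \<gamma> \<delta> l0 l1 l2 l3 \<sigma>)) (span {vf v}) (span {vf w})"
    unfolding G_equivalent_def G_ess_def by blast
  have "vf w \<in> span {vf w}"
    by (simp add: span_base)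
  then obtain X where "X \<in> span {vf v}" "is_pushforward (point_transf \<alpha> \<beta> \<gamma> \<delta> l0 l1 l2 l3 \<sigma>) X (vf w)"
    using *(3) unfolding rel_set_def by blast
  then obtain r where "is_pushforward (point_transf \<alpha> \<beta> \<gamma> \<delta> l0 l1 l2 l3 \<sigma>) (vf (r *\<^sub>R v)) (vf w)"
    by (auto simp: span_singleton linear_scale[OF linear_vf])
  then have w: "w = r *\<^sub>R ad_M \<alpha> \<beta> \<gamma> \<delta> (ad_H l0 l1 l2 l3 v)"
    using is_pushforward_vf_iff[OF *(1,2)] by (simp add: ad_M_scaleR ad_H_scaleR)
  with assms have "r \<noteq> 0" by auto
  with w *(1) show "coeff_equiv v w"
    unfolding coeff_equiv_def by blast
next
  assume "coeff_equiv v w"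
  then obtain \<alpha> \<beta> \<gamma> \<delta> l0 l1 l2 l3 r where *: "\<alpha> * \<delta> - \<beta> * \<gamma> = 1" "r \<noteq> 0"
    "w = r *\<^sub>R ad_M \<alpha> \<beta> \<gamma> \<delta> (ad_H l0 l1 l2 l3 v)"
    unfolding coeff_equiv_def by blast
  have "is_pushforward (point_transf \<alpha> \<beta> \<gamma> \<delta> l0 l1 l2 l3 1) (c *\<^sub>R vf v) ((c / r) *\<^sub>R vf w)" for c
    using *(2) is_pushforward_ad[OF *(1), of l0 l1 l2 l3 1 "c *\<^sub>R v"]
    by (simp add: *(3) linear_scale[OF linear_vf] ad_M_scaleR ad_H_scaleR)
  moreover from this[of "c * r" for c] *(2)
  have "is_pushforward (point_transf \<alpha> \<beta> \<gamma> \<delta> l0 l1 l2 l3 1) ((c * r) *\<^sub>R vf v) (c *\<^sub>R vf w)" for c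
    by simp
  ultimately have "rel_set (is_pushforward (point_transf \<alpha> \<beta> \<gamma> \<delta> l0 l1 l2 l3 1)) (span {vf v}) (span {vf w})"
    unfolding rel_set_def span_singleton by blast
  then show "G_equivalent (span {vf v}) (span {vf w})"
    using *(1) unfolding G_equivalent_def G_ess_def by fastforce
qed

text \<open>The forms are substituted by the adjugate matrix, which is multiplicative up to order
  for all matrices. So no determinant condition is needed, and a matrix times its adjugate gives the
  determinant times the identity.\<close>

lemma ad_M_ad_M:
  "ad_M \<alpha> \<beta> \<gamma> \<delta> (ad_M \<alpha>' \<beta>' \<gamma>' \<delta>' v) =
    ad_M (\<alpha> * \<alpha>' + \<beta> * \<gamma>') (\<alpha> * \<beta>' + \<beta> * \<delta>') (\<gamma> * \<alpha>' + \<delta> * \<gamma>') (\<gamma> * \<beta>' + \<delta> * \<delta>') v"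
proof -
  obtain a b c p3 p2 p1 p0 k where v: "v = (a, b, c, p3, p2, p1, p0, k)"
    by (metis surj_pair)
  show ?thesis
    unfolding v ad_M.simps prod.inject by (intro conjI; (rule refl | algebra))
qed

lemma ad_M_id: "ad_M 1 0 0 1 v = v"
  by (cases "(0 :: real, 0 :: real, 0 :: real, 0 :: real, v)" rule: ad_M.cases) simp

lemma ad_H_id: "ad_H 0 0 0 0 v = v"
  by (cases "(0 :: real, 0 :: real, 0 :: real, 0 :: real, v)" rule: ad_M.cases) simp

text \<open>The fields P^0, ..., P^3 do not commute, but their brackets are multiples of I, which is
  central and acts trivially. Hence the shifts add even in the quadratic last component.\<close>

lemma ad_H_ad_H:
  "ad_H l0 l1 l2 l3 (ad_H m0 m1 m2 m3 v) = ad_H (l0 + m0) (l1 + m1) (l2 + m2) (l3 + m3) v"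
proof -
  obtain a b c p3 p2 p1 p0 k where v: "v = (a, b, c, p3, p2, p1, p0, k)"
    by (metis surj_pair)
  show ?thesis
    unfolding v ad_H.simps prod.inject by (intro conjI; (rule refl | algebra))
qed

text \<open>The shift of the cubic, its pairing with \<open>l\<close> and the quadratic term in \<open>l\<close> are covariants of
  \<open>SL(2)\<close>, so they are compared up to powers of the determinant.\<close>

lemma ad_H_ad_M:
  assumes det: "\<alpha> * \<delta> - \<beta> * \<gamma> = 1"
    and l: "ad_M \<alpha> \<beta> \<gamma> \<delta> (0, 0, 0, m3, m2, m1, m0, 0) = (0, 0, 0, l3, l2, l1, l0, 0)"
  shows "ad_H l0 l1 l2 l3 (ad_M \<alpha> \<beta> \<gamma> \<delta> v) = ad_M \<alpha> \<beta> \<gamma> \<delta> (ad_H m0 m1 m2 m3 v)"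
proof -
  obtain a b c p3 p2 p1 p0 k where v: "v = (a, b, c, p3, p2, p1, p0, k)"
    by (metis surj_pair)
  let ?d = "\<alpha> * \<delta> - \<beta> * \<gamma>"
  obtain a' b' c' p3' p2' p1' p0' where ad: "ad_M \<alpha> \<beta> \<gamma> \<delta> v = (a', b', c', p3', p2', p1', p0', k)"
    and eqs: "a' = a * \<alpha>\<^sup>2 - 2 * b * \<alpha> * \<beta> + c * \<beta>\<^sup>2"
      "b' = - a * \<alpha> * \<gamma> + b * (\<alpha> * \<delta> + \<beta> * \<gamma>) - c * \<beta> * \<delta>"
      "c' = a * \<gamma>\<^sup>2 - 2 * b * \<gamma> * \<delta> + c * \<delta>\<^sup>2"
      "p3' = p3 * \<delta> ^ 3 - p2 * \<delta>\<^sup>2 * \<gamma> + p1 * \<delta> * \<gamma>\<^sup>2 - p0 * \<gamma> ^ 3"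
      "p2' = - 3 * p3 * \<delta>\<^sup>2 * \<beta> + p2 * (\<delta>\<^sup>2 * \<alpha> + 2 * \<delta> * \<beta> * \<gamma>) - p1 * (\<beta> * \<gamma>\<^sup>2 + 2 * \<delta> * \<alpha> * \<gamma>) + 3 * p0 * \<alpha> * \<gamma>\<^sup>2"
      "p1' = 3 * p3 * \<delta> * \<beta>\<^sup>2 - p2 * (2 * \<delta> * \<beta> * \<alpha> + \<beta>\<^sup>2 * \<gamma>) + p1 * (\<delta> * \<alpha>\<^sup>2 + 2 * \<beta> * \<alpha> * \<gamma>) - 3 * p0 * \<alpha>\<^sup>2 * \<gamma>"
      "p0' = - p3 * \<beta> ^ 3 + p2 * \<beta>\<^sup>2 * \<alpha> - p1 * \<beta> * \<alpha>\<^sup>2 + p0 * \<alpha> ^ 3"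
    by (simp add: v)
  have L: "l3 = m3 * \<delta> ^ 3 - m2 * \<delta>\<^sup>2 * \<gamma> + m1 * \<delta> * \<gamma>\<^sup>2 - m0 * \<gamma> ^ 3"
     "l2 = - 3 * m3 * \<delta>\<^sup>2 * \<beta> + m2 * (\<delta>\<^sup>2 * \<alpha> + 2 * \<delta> * \<beta> * \<gamma>) - m1 * (\<beta> * \<gamma>\<^sup>2 + 2 * \<delta> * \<alpha> * \<gamma>) + 3 * m0 * \<alpha> * \<gamma>\<^sup>2"
     "l1 = 3 * m3 * \<delta> * \<beta>\<^sup>2 - m2 * (2 * \<delta> * \<beta> * \<alpha> + \<beta>\<^sup>2 * \<gamma>) + m1 * (\<delta> * \<alpha>\<^sup>2 + 2 * \<beta> * \<alpha> * \<gamma>) - 3 * m0 * \<alpha>\<^sup>2 * \<gamma>"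
     "l0 = - m3 * \<beta> ^ 3 + m2 * \<beta>\<^sup>2 * \<alpha> - m1 * \<beta> * \<alpha>\<^sup>2 + m0 * \<alpha> ^ 3"
    using l by simp_all
  \<comment> \<open>With \<open>?d\<close> kept as a factor, these identities hold unconditionally.
    Its exponents follow from degrees in the matrix entries: 2 + 3 against 3 for the shift, 3 + 3
    for the pairing, 2 + 3 + 3 for the quadratic term.\<close>
  have *: "3 * b' * l3 - c' * l2 = ?d *
      ((3 * b * m3 - c * m2) * \<delta> ^ 3 - (3 * a * m3 + b * m2 - 2 * c * m1) * \<delta>\<^sup>2 * \<gamma>
       + (2 * a * m2 - b * m1 - 3 * c * m0) * \<delta> * \<gamma>\<^sup>2 - (a * m1 - 3 * b * m0) * \<gamma> ^ 3)"
    "3 * a' * l3 + b' * l2 - 2 * c' * l1 = ?d *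
      (- 3 * (3 * b * m3 - c * m2) * \<delta>\<^sup>2 * \<beta> + (3 * a * m3 + b * m2 - 2 * c * m1) * (\<delta>\<^sup>2 * \<alpha> + 2 * \<delta> * \<beta> * \<gamma>)
       - (2 * a * m2 - b * m1 - 3 * c * m0) * (\<beta> * \<gamma>\<^sup>2 + 2 * \<delta> * \<alpha> * \<gamma>) + 3 * (a * m1 - 3 * b * m0) * \<alpha> * \<gamma>\<^sup>2)"
    "2 * a' * l2 - b' * l1 - 3 * c' * l0 = ?d *
      (3 * (3 * b * m3 - c * m2) * \<delta> * \<beta>\<^sup>2 - (3 * a * m3 + b * m2 - 2 * c * m1) * (2 * \<delta> * \<beta> * \<alpha> + \<beta>\<^sup>2 * \<gamma>)
       + (2 * a * m2 - b * m1 - 3 * c * m0) * (\<delta> * \<alpha>\<^sup>2 + 2 * \<beta> * \<alpha> * \<gamma>) - 3 * (a * m1 - 3 * b * m0) * \<alpha>\<^sup>2 * \<gamma>)"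
    "a' * l1 - 3 * b' * l0 = ?d *
      (- (3 * b * m3 - c * m2) * \<beta> ^ 3 + (3 * a * m3 + b * m2 - 2 * c * m1) * \<beta>\<^sup>2 * \<alpha>
       - (2 * a * m2 - b * m1 - 3 * c * m0) * \<beta> * \<alpha>\<^sup>2 + (a * m1 - 3 * b * m0) * \<alpha> ^ 3)"
    unfolding eqs L by algebra+
  have pair: "- 3 * p3' * l0 + p2' * l1 - p1' * l2 + 3 * p0' * l3
      = ?d ^ 3 * (- 3 * p3 * m0 + p2 * m1 - p1 * m2 + 3 * p0 * m3)"
    unfolding eqs L by algebra
  have quad: "- c' * l1\<^sup>2 + a' * (3 * l3 * l1 - l2\<^sup>2) + l2 * (b' * l1 + 3 * c' * l0) - 9 * l3 * b' * l0
      = ?d ^ 4 * (- c * m1\<^sup>2 + a * (3 * m3 * m1 - m2\<^sup>2) + m2 * (b * m1 + 3 * c * m0) - 9 * m3 * b * m0)"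
    unfolding eqs L by algebra
  show ?thesis
    unfolding ad unfolding v ad_H.simps ad_M.simps prod.inject
  proof (intro conjI)
    show "k - c' * l1\<^sup>2 - 3 * p3' * l0 + p2' * l1 + a' * (3 * l3 * l1 - l2\<^sup>2) - l2 * (p1' - b' * l1 - 3 * c' * l0)
       + 3 * l3 * (p0' - 3 * b' * l0)
      = k - c * m1\<^sup>2 - 3 * p3 * m0 + p2 * m1 + a * (3 * m3 * m1 - m2\<^sup>2) - m2 * (p1 - b * m1 - 3 * c * m0)
       + 3 * m3 * (p0 - 3 * b * m0)"
      using pair[unfolded det power_one mult_1] quad[unfolded det power_one mult_1] by algebra
  qed (use *[unfolded det mult_1] eqs in \<open>simp; algebra\<close>)+
qed

text \<open>SL(2) normalizes the shifts: \<lambda> is itself a binary cubic, and the required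
  \<open>m\<close> is the image of \<open>l\<close> under the inverse matrix.\<close>

lemma ad_H_ad_M_swap:
  assumes det: "\<alpha> * \<delta> - \<beta> * \<gamma> = 1"
  shows "\<exists>m0 m1 m2 m3. ad_H l0 l1 l2 l3 (ad_M \<alpha> \<beta> \<gamma> \<delta> v) = ad_M \<alpha> \<beta> \<gamma> \<delta> (ad_H m0 m1 m2 m3 v)"
proof -
  obtain m3 m2 m1 m0 where m: "ad_M \<delta> (- \<beta>) (- \<gamma>) \<alpha> (0, 0, 0, l3, l2, l1, l0, 0) = (0, 0, 0, m3, m2, m1, m0, 0)"
    by simp
  have "ad_M \<alpha> \<beta> \<gamma> \<delta> (0, 0, 0, m3, m2, m1, m0, 0) = ad_M (\<alpha> * \<delta> - \<beta> * \<gamma>) 0 0 (\<alpha> * \<delta> - \<beta> * \<gamma>) (0, 0, 0, l3, l2, l1, l0, 0)"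
    unfolding m[symmetric] ad_M_ad_M by (simp add: mult.commute)
  then show ?thesis
    unfolding det ad_M_id using ad_H_ad_M[OF det] by blast
qed

lemma coeff_equiv_refl: "coeff_equiv v v"
  unfolding coeff_equiv_def
  by (rule exI[of _ 1], rule exI[of _ 0], rule exI[of _ 0], rule exI[of _ 1], rule exI[of _ 0], rule exI[of _ 0],
      rule exI[of _ 0], rule exI[of _ 0], rule exI[of _ 1])
    (simp add: ad_M_id ad_H_id)

lemma coeff_equivI:
  "\<alpha> * \<delta> - \<beta> * \<gamma> = 1 \<Longrightarrow> r \<noteq> 0 \<Longrightarrow> w = r *\<^sub>R ad_M \<alpha> \<beta> \<gamma> \<delta> (ad_H l0 l1 l2 l3 v) \<Longrightarrow> coeff_equiv v w"
  unfolding coeff_equiv_def by blast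

text \<open>The inner matrix and the outer shift must be interchanged before matrices can be
  multiplied and shifts added.\<close>

lemma coeff_equiv_trans [trans]:
  assumes "coeff_equiv u v" "coeff_equiv v w"
  shows "coeff_equiv u w"
proof -
  obtain \<alpha> \<beta> \<gamma> \<delta> l0 l1 l2 l3 r where 1: "\<alpha> * \<delta> - \<beta> * \<gamma> = 1" "r \<noteq> 0"
    "v = r *\<^sub>R ad_M \<alpha> \<beta> \<gamma> \<delta> (ad_H l0 l1 l2 l3 u)"
    using assms(1) unfolding coeff_equiv_def by blast
  obtain \<alpha>' \<beta>' \<gamma>' \<delta>' m0 m1 m2 m3 q where 2: "\<alpha>' * \<delta>' - \<beta>' * \<gamma>' = 1" "q \<noteq> 0"
    "w = q *\<^sub>R ad_M \<alpha>' \<beta>' \<gamma>' \<delta>' (ad_H m0 m1 m2 m3 v)"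
    using assms(2) unfolding coeff_equiv_def by blast
  obtain n0 n1 n2 n3 where 3: "ad_H m0 m1 m2 m3 (ad_M \<alpha> \<beta> \<gamma> \<delta> (ad_H l0 l1 l2 l3 u)) =
      ad_M \<alpha> \<beta> \<gamma> \<delta> (ad_H n0 n1 n2 n3 (ad_H l0 l1 l2 l3 u))"
    using ad_H_ad_M_swap[OF 1(1)] by blast
  show ?thesis
  proof (rule coeff_equivI)
    show "w = (q * r) *\<^sub>R ad_M (\<alpha>' * \<alpha> + \<beta>' * \<gamma>) (\<alpha>' * \<beta> + \<beta>' * \<delta>) (\<gamma>' * \<alpha> + \<delta>' * \<gamma>) (\<gamma>' * \<beta> + \<delta>' * \<delta>)
        (ad_H (n0 + l0) (n1 + l1) (n2 + l2) (n3 + l3) u)"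
      by (simp add: 2(3) 1(3) ad_M_scaleR ad_H_scaleR 3 ad_M_ad_M ad_H_ad_H)
    show "(\<alpha>' * \<alpha> + \<beta>' * \<gamma>) * (\<gamma>' * \<beta> + \<delta>' * \<delta>) - (\<alpha>' * \<beta> + \<beta>' * \<delta>) * (\<gamma>' * \<alpha> + \<delta>' * \<gamma>) = 1"
      using 1(1) 2(1) by algebra
  qed (use 1 2 in simp)
qed

lemma coeff_equiv_sym:
  assumes "coeff_equiv v w"
  shows "coeff_equiv w v"
proof -
  obtain \<alpha> \<beta> \<gamma> \<delta> l0 l1 l2 l3 r where 1: "\<alpha> * \<delta> - \<beta> * \<gamma> = 1" "r \<noteq> 0"
    "w = r *\<^sub>R ad_M \<alpha> \<beta> \<gamma> \<delta> (ad_H l0 l1 l2 l3 v)"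
    using assms unfolding coeff_equiv_def by blast
  have "ad_M \<delta> (- \<beta>) (- \<gamma>) \<alpha> (ad_M \<alpha> \<beta> \<gamma> \<delta> x) = x" for x
    using 1(1) by (simp add: ad_M_ad_M mult.commute ad_M_id)
  then have "v = ad_H (- l0) (- l1) (- l2) (- l3) (ad_M \<delta> (- \<beta>) (- \<gamma>) \<alpha> ((1 / r) *\<^sub>R w))"
    using 1(2) by (simp add: 1(3) ad_M_scaleR ad_H_ad_H ad_H_id)
  moreover have det: "\<delta> * \<alpha> - (- \<beta>) * (- \<gamma>) = 1"
    using 1(1) by (simp add: mult.commute)
  ultimately obtain m0 m1 m2 m3 where "v = ad_M \<delta> (- \<beta>) (- \<gamma>) \<alpha> (ad_H m0 m1 m2 m3 ((1 / r) *\<^sub>R w))"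
    using ad_H_ad_M_swap[OF det] by metis
  then have "v = (1 / r) *\<^sub>R ad_M \<delta> (- \<beta>) (- \<gamma>) \<alpha> (ad_H m0 m1 m2 m3 w)"
    by (simp only: ad_M_scaleR ad_H_scaleR)
  with det 1(2) show ?thesis
    by (intro coeff_equivI) auto
qed

lemma coeff_equiv_M:
  "\<alpha> * \<delta> - \<beta> * \<gamma> = 1 \<Longrightarrow> r \<noteq> 0 \<Longrightarrow> w = r *\<^sub>R ad_M \<alpha> \<beta> \<gamma> \<delta> v \<Longrightarrow> coeff_equiv v w"
  using coeff_equivI[of \<alpha> \<delta> \<beta> \<gamma> r w 0 0 0 0 v] unfolding ad_H_id by blast

lemma coeff_equiv_H: "w = ad_H l0 l1 l2 l3 v \<Longrightarrow> coeff_equiv v w"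
  using coeff_equivI[of 1 1 0 0 1 w l0 l1 l2 l3 v] unfolding ad_M_id scaleR_one by simp

lemma coeff_equiv_scale: "r \<noteq> 0 \<Longrightarrow> w = r *\<^sub>R v \<Longrightarrow> coeff_equiv v w"
  using coeff_equiv_M[of 1 1 0 0 r w v] unfolding ad_M_id by simp

lemma coeff_equiv_diag:
  assumes "\<alpha> \<noteq> 0" "r \<noteq> 0"
    and "(a', b', c') = (r * a * \<alpha>\<^sup>2, r * b, r * c / \<alpha>\<^sup>2)"
    and "(q3, q2, q1, q0) = (r * p3 / \<alpha> ^ 3, r * p2 / \<alpha>, r * p1 * \<alpha>, r * p0 * \<alpha> ^ 3)"
    and "k' = r * k"
  shows "coeff_equiv (a, b, c, p3, p2, p1, p0, k) (a', b', c', q3, q2, q1, q0, k')"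
proof -
  have "r *\<^sub>R ad_M \<alpha> 0 0 (1 / \<alpha>) (a, b, c, p3, p2, p1, p0, k) = (a', b', c', q3, q2, q1, q0, k')"
    using assms by (simp add: power_divide power2_eq_square)
  moreover have "\<alpha> * (1 / \<alpha>) - 0 * 0 = 1"
    using assms(1) by simp
  ultimately show ?thesis
    using coeff_equiv_M[OF _ assms(2)] by metis
qed

lemma coeff_equiv_Weyl: "r \<noteq> 0 \<Longrightarrow> w = r *\<^sub>R ad_M 0 1 (- 1) 0 v \<Longrightarrow> coeff_equiv v w"
  using coeff_equiv_M[of 0 0 1 "- 1" r w v] by simp

section \<open>Normal forms of the quadratic part\<close>

definition sl2_reduces :: "real \<times> real \<times> real \<Rightarrow> real \<times> real \<times> real \<Rightarrow> bool" where
  "sl2_reduces = (\<lambda>(a, b, c) (a', b', c'). \<forall>q. \<exists>q'. coeff_equiv (a, b, c, q) (a', b', c', q'))"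

lemma sl2_reduces_refl: "sl2_reduces s s"
  unfolding sl2_reduces_def using coeff_equiv_refl by (cases s) (simp only: prod.case, blast)

lemma sl2_reduces_trans [trans]:
  "sl2_reduces s s' \<Longrightarrow> sl2_reduces s' s'' \<Longrightarrow> sl2_reduces s s''"
  unfolding sl2_reduces_def
  by (cases s; cases s'; cases s'') (simp only: prod.case, blast intro: coeff_equiv_trans)

lemma sl2_reducesI:
  assumes "\<alpha> * \<delta> - \<beta> * \<gamma> = 1" "r \<noteq> 0"
    "a' = r * (a * \<alpha>\<^sup>2 - 2 * b * \<alpha> * \<beta> + c * \<beta>\<^sup>2)"
    "b' = r * (- a * \<alpha> * \<gamma> + b * (\<alpha> * \<delta> + \<beta> * \<gamma>) - c * \<beta> * \<delta>)"
    "c' = r * (a * \<gamma>\<^sup>2 - 2 * b * \<gamma> * \<delta> + c * \<delta>\<^sup>2)"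
  shows "sl2_reduces (a, b, c) (a', b', c')"
  unfolding sl2_reduces_def prod.case
proof
  fix q :: "real \<times> real \<times> real \<times> real \<times> real"
  obtain p3 p2 p1 p0 k where q: "q = (p3, p2, p1, p0, k)"
    by (metis surj_pair)
  have "r *\<^sub>R ad_M \<alpha> \<beta> \<gamma> \<delta> (a, b, c, q) =
      (a', b', c', snd (snd (snd (r *\<^sub>R ad_M \<alpha> \<beta> \<gamma> \<delta> (a, b, c, q)))))"
    unfolding q ad_M.simps scaleR_Pair snd_conv assms(3-5) real_scaleR_def by (rule refl)
  then show "\<exists>q'. coeff_equiv (a, b, c, q) (a', b', c', q')"
    using coeff_equiv_M[OF assms(1,2) refl, of "(a, b, c, q)"] by (intro exI) (rule subst)
qed

lemma sl2_normal_form: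
  assumes "s \<noteq> (0, 0, 0)"
  obtains s' where "sl2_reduces s s'" "s' \<in> {(1, 0, 0), (0, 1, 0), (1, 0, 1)}"
proof -
  obtain a b c where s: "s = (a, b, c)" by (metis surj_pair)
  \<comment> \<open>Completing the square below needs a nonzero first entry.\<close>
  have "\<exists>a' b' c'. sl2_reduces s (a', b', c') \<and> a' \<noteq> 0"
  proof -
    consider "a \<noteq> 0" | "a = 0" "c \<noteq> 0" | "a = 0" "c = 0" "b \<noteq> 0" using assms s by auto
    then show ?thesis
    proof cases
      case 1 then show ?thesis using sl2_reduces_refl s by blast
    next
      case 2
      have "sl2_reduces (a, b, c) (c, - b, a)"
        by (rule sl2_reducesI[of 0 0 1 "- 1" 1]) auto
      then show ?thesis using 2 s by blast
    next
      case 3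
      have "sl2_reduces (a, b, c) (- 2 * b, b, 0)"
        by (rule sl2_reducesI[of 1 1 1 0 1]) (use 3 in auto)
      then show ?thesis using 3 s by fastforce
    qed
  qed
  then obtain a' b' c' where 1: "sl2_reduces s (a', b', c')" "a' \<noteq> 0" by blast
  define d where "d = (c' - b'\<^sup>2 / a') / a'"
  have "sl2_reduces (a', b', c') (1, 0, d)"
    by (rule sl2_reducesI[of 1 1 0 "b' / a'" "1 / a'"])
      (use 1 in \<open>auto simp: d_def power2_eq_square field_simps\<close>)
  then have 2: "sl2_reduces s (1, 0, d)"
    using 1 sl2_reduces_trans by blast
  consider "d = 0" | "d > 0" | "d < 0" by linarith
  then show thesis
  proof cases
    case 1 then show thesis using that 2 by blast
  next
    case pos: 2
    \<comment> \<open>A diagonal matrix changes the ratio of the outer entries by the fourth power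
      of \<alpha>; the factor \<open>r\<close> then restores the first entry.\<close>
    define \<alpha> where "\<alpha> = root 4 d"
    have \<alpha>: "\<alpha> \<noteq> 0" "d = \<alpha> ^ 4" using pos by (simp_all add: \<alpha>_def real_root_pow_pos2)
    have "sl2_reduces (1, 0, d) (1, 0, 1)"
      by (rule sl2_reducesI[of \<alpha> "1 / \<alpha>" 0 0 "1 / \<alpha>\<^sup>2"])
        (simp_all add: \<alpha>(1), simp add: \<alpha> power4_eq_xxxx power2_eq_square)
    then show thesis using that 2 sl2_reduces_trans by blast
  next
    case neg: 3
    define \<alpha> where "\<alpha> = sqrt (- d)"
    have \<alpha>: "\<alpha> \<noteq> 0" "d = - \<alpha>\<^sup>2" using neg by (auto simp: \<alpha>_def)
    \<comment> \<open>The form has the roots \<open>1 / \<alpha>\<close> and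
      \<open>- 1 / \<alpha>\<close>; the Moebius map of this matrix sends them to infinity and 0,
      the roots of the form of D.\<close>
    have "sl2_reduces (1, 0, d) (0, 1, 0)"
      by (rule sl2_reducesI[of 1 "1 / 2" "1 / \<alpha>" "- \<alpha> / 2" "1 / \<alpha>"])
        (simp_all add: \<alpha> power2_eq_square)
    then show thesis using that 2 sl2_reduces_trans by blast
  qed
qed

section \<open>Reduction to the listed representatives\<close>

fun representative :: "label \<Rightarrow> coeffs" where
  "representative S1 = (1, 0, 0, 1, 0, 0, 0, 0)"
| "representative (S2 \<delta>) = (1, 0, 0, 0, 0, 0, 0, \<delta>)"
| "representative (S3 \<nu>) = (0, 1, 0, 0, 0, 0, 0, \<nu>)"
| "representative (S4 \<mu>) = (1, 0, 1, 0, 0, 0, 0, \<mu>)"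
| "representative (S5 \<epsilon>) = (0, 0, 0, 0, 1, 0, \<epsilon>, 0)"
| "representative S6 = (0, 0, 0, 0, 0, 1, 0, 0)"
| "representative S7 = (0, 0, 0, 0, 0, 0, 1, 0)"
| "representative S8 = (0, 0, 0, 0, 0, 0, 0, 1)"

lemma listed_subalgebra_eq: "listed_subalgebra i = span {vf (representative i)}"
  by (cases i) (simp_all add: vf_def)

lemma representative_neq_0: "representative i \<noteq> 0"
  by (cases i) (simp_all add: zero_prod_def)

definition normalizable :: "coeffs \<Rightarrow> bool" where
  "normalizable v \<longleftrightarrow> (\<exists>i\<in>admissible_labels. coeff_equiv v (representative i))"

lemma normalizable_representative: "i \<in> admissible_labels \<Longrightarrow> v = representative i \<Longrightarrow> normalizable v"
  using coeff_equiv_refl unfolding normalizable_def by blast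

lemma normalizable_equiv: "coeff_equiv v w \<Longrightarrow> normalizable w \<Longrightarrow> normalizable v"
  using coeff_equiv_trans unfolding normalizable_def by blast

lemma shift_nilradical_part:
  assumes "q3 = p3 + 3 * b * l3 - c * l2" "q2 = p2 + 3 * a * l3 + b * l2 - 2 * c * l1"
    "q1 = p1 + 2 * a * l2 - b * l1 - 3 * c * l0" "q0 = p0 + a * l1 - 3 * b * l0"
  obtains k' where "coeff_equiv (a, b, c, p3, p2, p1, p0, k) (a, b, c, q3, q2, q1, q0, k')"
  using coeff_equiv_H[OF refl, of "(a, b, c, p3, p2, p1, p0, k)" l0 l1 l2 l3]
  unfolding ad_H.simps assms[symmetric] by (rule that)

text \<open>For T = 1 a shift adds L' to the cubic: minus an antiderivative of the lower terms
  removes them, while \<open>p3\<close> is out of reach.\<close>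

lemma normalizable_parabolic: "normalizable (1, 0, 0, p3, p2, p1, p0, k)"
proof -
  obtain k' where "coeff_equiv (1, 0, 0, p3, p2, p1, p0, k) (1, 0, 0, p3, 0, 0, 0, k')"
    by (rule shift_nilradical_part[of p3 p3 0 "- p2 / 3" 0 "- p1 / 2" 0 p2 1 "- p0" 0 p1 0 0 p0]) simp_all
  moreover have "normalizable (1, 0, 0, p3, 0, 0, 0, k')"
  proof (cases "p3 = 0")
    case False
    \<comment> \<open>Keeping the first entry 1 forces \<open>r = 1 / \<alpha>^2\<close>, so
      \<open>p3\<close> is divided by \<open>\<alpha>^5\<close>. The odd power also removes its
      sign.\<close>
    define \<alpha> where "\<alpha> = root 5 p3"
    have \<alpha>: "p3 = \<alpha> ^ 5" "\<alpha> \<noteq> 0"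
      using False by (simp_all add: \<alpha>_def odd_real_root_pow)
    \<comment> \<open>A constant L leaves the cubic alone and moves the last entry by
      \<open>- 3 * p3 * l0\<close>.\<close>
    have "coeff_equiv (1, 0, 0, p3, 0, 0, 0, k') (1, 0, 0, p3, 0, 0, 0, 0)"
      by (rule coeff_equiv_H[of _ "k' / (3 * p3)" 0 0 0]) (use False in simp)
    also have "coeff_equiv \<dots> (representative S1)"
      unfolding representative.simps
      by (rule coeff_equiv_diag[of \<alpha> "1 / \<alpha>\<^sup>2"]) (use \<alpha>(2) in \<open>simp_all add: \<alpha>(1) flip: power_add\<close>)
    finally show ?thesis
      by (rule normalizable_equiv) (rule normalizable_representative[of S1], simp_all add: admissible_labels_def)
  next
    case True
    show ?thesis
    proof (cases "k' = 0")
      case True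
      with \<open>p3 = 0\<close> show ?thesis
        by (intro normalizable_representative[of "S2 0"]) (simp_all add: admissible_labels_def)
    next
      case False
      \<comment> \<open>The scaling that fixes the first entry divides \<open>k'\<close> by the
        square of \<alpha>, so its sign remains.\<close>
      have "coeff_equiv (1, 0, 0, 0, 0, 0, 0, k') (representative (S2 (sgn k')))"
        unfolding representative.simps
        by (rule coeff_equiv_diag[of "sqrt \<bar>k'\<bar>" "1 / \<bar>k'\<bar>"]) (use False in \<open>simp_all add: sgn_if\<close>)
      moreover have "S2 (sgn k') \<in> admissible_labels"
        by (simp add: admissible_labels_def sgn_if)
      ultimately show ?thesis
        using \<open>p3 = 0\<close> unfolding normalizable_def by blast
    qed
  qed
  ultimately show ?thesis using normalizable_equiv by blast
qed

text \<open>For T = 2 t the shift multiplies the four coefficients of \<lambda> by 3, 1, -1, -3; all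
  are nonzero, so the cubic can be removed.\<close>

lemma normalizable_hyperbolic: "normalizable (0, 1, 0, p3, p2, p1, p0, k)"
proof -
  obtain k' where 1: "coeff_equiv (0, 1, 0, p3, p2, p1, p0, k) (0, 1, 0, 0, 0, 0, 0, k')"
    by (rule shift_nilradical_part[of 0 p3 1 "- p3 / 3" 0 "- p2" 0 p2 0 p1 0 p1 "p0 / 3" 0 p0]) simp_all
  \<comment> \<open>The Weyl element reverses D and fixes I; the overall factor -1 restores D and
    flips the parameter.\<close>
  have "coeff_equiv (representative (S3 k')) (representative (S3 (- k')))"
    by (rule coeff_equiv_Weyl[of "- 1"]) simp_all
  then have "coeff_equiv (representative (S3 k')) (representative (S3 \<bar>k'\<bar>))"
    unfolding abs_real_def by (simp only: coeff_equiv_refl split: if_split) simp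
  moreover have "S3 \<bar>k'\<bar> \<in> admissible_labels"
    by (simp add: admissible_labels_def)
  ultimately show ?thesis
    using coeff_equiv_trans[OF 1[folded representative.simps]] unfolding normalizable_def by blast
qed

text \<open>For T = 1 + t^2 the shift is invertible on cubics, with eigenvalues i, -i, 3i, -3i; the
  witnesses solve the resulting linear system.\<close>

lemma normalizable_elliptic: "normalizable (1, 0, 1, p3, p2, p1, p0, k)"
proof -
  obtain k' where 1: "coeff_equiv (1, 0, 1, p3, p2, p1, p0, k) (1, 0, 1, 0, 0, 0, 0, k')"
    by (rule shift_nilradical_part[of 0 p3 0 "- p2 / 3 - 2 * p0 / 3" 1 p3 0 p2 1 "- p0" 0 p1 "(p1 + 2 * p3) / 3" 0 p0]) simp_all
  moreover have "S4 k' \<in> admissible_labels"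
    by (simp add: admissible_labels_def)
  ultimately show ?thesis
    unfolding normalizable_def by (intro bexI[of _ "S4 k'"]) (simp_all only: representative.simps)
qed

text \<open>At distance \<open>M\<close> from 0 the lower terms of the monic cubic are at most
  \<open>M ^ 3\<close>, so the leading term decides the signs and the intermediate value theorem
  applies.\<close>

lemma cubic_root_exists:
  fixes a b c d :: real
  assumes "a \<noteq> 0"
  obtains x where "a * x ^ 3 + b * x\<^sup>2 + c * x + d = 0"
proof -
  define B C D where "B = b / a" and "C = c / a" and "D = d / a"
  define p where "p = (\<lambda>x. x ^ 3 + (B * x\<^sup>2 + C * x + D))"
  define M where "M = 1 + (\<bar>B\<bar> + \<bar>C\<bar> + \<bar>D\<bar>)"
  have M: "M \<ge> 1" by (simp add: M_def)
  have bound: "\<bar>B * x\<^sup>2 + C * x + D\<bar> \<le> M ^ 3" if "\<bar>x\<bar> = M" for x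
  proof -
    have "M \<le> M\<^sup>2" "1 \<le> M\<^sup>2"
      using M by (simp_all add: self_le_power)
    then have "\<bar>C\<bar> * M \<le> \<bar>C\<bar> * M\<^sup>2" "\<bar>D\<bar> * 1 \<le> \<bar>D\<bar> * M\<^sup>2"
      by (intro mult_left_mono; simp)+
    moreover have "\<bar>B * x\<^sup>2\<bar> = \<bar>B\<bar> * M\<^sup>2" "\<bar>C * x\<bar> = \<bar>C\<bar> * M"
      unfolding that[symmetric] by (simp_all add: abs_mult)
    ultimately have "\<bar>B * x\<^sup>2 + C * x + D\<bar> \<le> \<bar>B\<bar> * M\<^sup>2 + \<bar>C\<bar> * M\<^sup>2 + \<bar>D\<bar> * M\<^sup>2"
      by linarith
    also have "\<dots> = (M - 1) * M\<^sup>2"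
      by (simp add: M_def algebra_simps)
    also have "\<dots> \<le> M * M\<^sup>2"
      by (intro mult_right_mono) simp_all
    finally show ?thesis by (simp add: power3_eq_cube power2_eq_square)
  qed
  have "p (- M) \<le> 0" "0 \<le> p M"
    using bound[of M] bound[of "- M"] M by (simp_all add: p_def)
  moreover have "- M \<le> M" using M by simp
  moreover have "continuous_on {- M..M} p"
    unfolding p_def by (intro continuous_intros)
  ultimately obtain x where "p x = 0"
    using IVT'[of p "- M" 0 M] by blast
  then have "a * (x ^ 3 + (B * x\<^sup>2 + C * x + D)) = 0"
    by (simp add: p_def)
  moreover have "a * B = b" "a * C = c" "a * D = d"
    using assms by (simp_all add: B_def C_def D_def)
  ultimately have "a * x ^ 3 + b * x\<^sup>2 + c * x + d = 0"
    by algebra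
  then show thesis by (rule that)
qed

lemma coeff_equiv_cubicI:
  assumes "\<alpha> * \<delta> - \<beta> * \<gamma> = 1"
    "q3 = p3 * \<delta> ^ 3 - p2 * \<delta>\<^sup>2 * \<gamma> + p1 * \<delta> * \<gamma>\<^sup>2 - p0 * \<gamma> ^ 3"
    "q2 = - 3 * p3 * \<delta>\<^sup>2 * \<beta> + p2 * (\<delta>\<^sup>2 * \<alpha> + 2 * \<delta> * \<beta> * \<gamma>) - p1 * (\<beta> * \<gamma>\<^sup>2 + 2 * \<delta> * \<alpha> * \<gamma>) + 3 * p0 * \<alpha> * \<gamma>\<^sup>2"
    "q1 = 3 * p3 * \<delta> * \<beta>\<^sup>2 - p2 * (2 * \<delta> * \<beta> * \<alpha> + \<beta>\<^sup>2 * \<gamma>) + p1 * (\<delta> * \<alpha>\<^sup>2 + 2 * \<beta> * \<alpha> * \<gamma>) - 3 * p0 * \<alpha>\<^sup>2 * \<gamma>"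
    "q0 = - p3 * \<beta> ^ 3 + p2 * \<beta>\<^sup>2 * \<alpha> - p1 * \<beta> * \<alpha>\<^sup>2 + p0 * \<alpha> ^ 3"
  shows "coeff_equiv (0, 0, 0, p3, p2, p1, p0, k) (0, 0, 0, q3, q2, q1, q0, k)"
proof -
  have "ad_M \<alpha> \<beta> \<gamma> \<delta> (0, 0, 0, p3, p2, p1, p0, k) = (0, 0, 0, q3, q2, q1, q0, k)"
    unfolding ad_M.simps assms(2-5) by simp
  then show ?thesis
    using coeff_equiv_M[OF assms(1) one_neq_zero, of "(0, 0, 0, q3, q2, q1, q0, k)" "(0, 0, 0, p3, p2, p1, p0, k)"]
    by (simp only: scaleR_one)
qed

lemma normalizable_nilradical_p2:
  assumes "p2 \<noteq> 0"
  shows "normalizable (0, 0, 0, 0, p2, 0, p0, 0)"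
proof -
  define q where "q = p0 / p2"
  have 1: "coeff_equiv (0, 0, 0, 0, p2, 0, p0, 0) (0, 0, 0, 0, 1, 0, q, 0)"
    by (rule coeff_equiv_scale[of "1 / p2"]) (use assms in \<open>simp_all add: q_def\<close>)
  have "normalizable (0, 0, 0, 0, 1, 0, q, 0)"
  proof (cases "q = 0")
    case True
    \<comment> \<open>As binary cubics, both forms have one double and one simple root, at 0 and
      infinity; the Weyl element exchanges the two.\<close>
    have "coeff_equiv (0, 0, 0, 0, 1, 0, q, 0) (representative S6)"
      unfolding True representative.simps by (rule coeff_equiv_cubicI[of 0 0 1 "- 1"]) simp_all
    then show ?thesis
      by (rule normalizable_equiv) (rule normalizable_representative[of S6], simp_all add: admissible_labels_def)
  next
    case False
    \<comment> \<open>Keeping the coefficient of P^2 equal to 1 forces \<open>r = \<alpha>\<close>,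
      so \<open>q\<close> is multiplied by \<open>\<alpha> ^ 4\<close> and only its sign
      persists.\<close>
    define \<alpha> where "\<alpha> = root 4 (1 / \<bar>q\<bar>)"
    have \<alpha>: "\<alpha> \<noteq> 0" "\<alpha> ^ 4 = 1 / \<bar>q\<bar>"
      using False by (simp_all add: \<alpha>_def real_root_pow_pos2)
    have "\<alpha> * q * \<alpha> ^ 3 = q * \<alpha> ^ 4"
      by (simp add: power4_eq_xxxx power3_eq_cube)
    then have "sgn q = \<alpha> * q * \<alpha> ^ 3"
      using False by (simp add: \<alpha>(2) sgn_if)
    then have "coeff_equiv (0, 0, 0, 0, 1, 0, q, 0) (representative (S5 (sgn q)))"
      unfolding representative.simps by (intro coeff_equiv_diag[of \<alpha> \<alpha>]) (simp_all add: \<alpha>(1))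
    then show ?thesis
      by (rule normalizable_equiv)
        (rule normalizable_representative[of "S5 (sgn q)"], use False in \<open>simp_all add: admissible_labels_def sgn_if\<close>)
  qed
  then show ?thesis using 1 normalizable_equiv by blast
qed

text \<open>The cubic has a root at infinity. The cases say whether this root is simple, double or
  triple; in the first two a translation kills one lower coefficient.\<close>

lemma normalizable_nilradical_p3_0:
  assumes "(p2, p1, p0) \<noteq> (0, 0, 0)"
  shows "normalizable (0, 0, 0, 0, p2, p1, p0, 0)"
proof -
  consider "p2 \<noteq> 0" | "p2 = 0" "p1 \<noteq> 0" | "p2 = 0" "p1 = 0" "p0 \<noteq> 0"
    using assms by auto
  then show ?thesis
  proof cases
    case 1
    let ?\<beta> = "p1 / (2 * p2)"
    have "coeff_equiv (0, 0, 0, 0, p2, p1, p0, 0) (0, 0, 0, 0, p2, 0, p2 * ?\<beta>\<^sup>2 - p1 * ?\<beta> + p0, 0)"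
      by (rule coeff_equiv_cubicI[of 1 1 ?\<beta> 0]) (use 1 in simp_all)
    then show ?thesis
      using normalizable_nilradical_p2[OF 1] by (rule normalizable_equiv)
  next
    case 2
    have "coeff_equiv (0, 0, 0, 0, p2, p1, p0, 0) (0, 0, 0, 0, 0, p1, 0, 0)"
      by (rule coeff_equiv_cubicI[of 1 1 "p0 / p1" 0]) (use 2 in simp_all)
    also have "coeff_equiv \<dots> (representative S6)"
      by (rule coeff_equiv_scale[of "1 / p1"]) (use 2 in simp_all)
    finally show ?thesis
      by (rule normalizable_equiv) (rule normalizable_representative[of S6], simp_all add: admissible_labels_def)
  next
    case 3
    have "coeff_equiv (0, 0, 0, 0, p2, p1, p0, 0) (representative S7)"
      by (rule coeff_equiv_scale[of "1 / p0"]) (use 3 in simp_all)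
    then show ?thesis
      by (rule normalizable_equiv) (rule normalizable_representative[of S7], simp_all add: admissible_labels_def)
  qed
qed

lemma normalizable_nilradical:
  assumes "(p3, p2, p1, p0, k) \<noteq> (0, 0, 0, 0, 0)"
  shows "normalizable (0, 0, 0, p3, p2, p1, p0, k)"
proof (cases "(p3, p2, p1, p0) = (0, 0, 0, 0)")
  case True
  have "coeff_equiv (0, 0, 0, p3, p2, p1, p0, k) (representative S8)"
    by (rule coeff_equiv_scale[of "1 / k"]) (use assms True in simp_all)
  then show ?thesis
    by (rule normalizable_equiv) (rule normalizable_representative[of S8], simp_all add: admissible_labels_def)
next
  case False
  txt \<open>Since \<open>k\<close> is shifted by the symplectic pairing of the cubic with \<open>l\<close>, choose \<open>l\<close> as a multiple
    of the symplectic dual of the cubic.\<close>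
  define n where "n = 9 * p3\<^sup>2 + p2\<^sup>2 + p1\<^sup>2 + 9 * p0\<^sup>2"
  have n: "n \<noteq> 0"
  proof
    assume "n = 0"
    then have "p3\<^sup>2 = 0" "p2\<^sup>2 = 0" "p1\<^sup>2 = 0" "p0\<^sup>2 = 0"
      using zero_le_power2[of p3] zero_le_power2[of p2] zero_le_power2[of p1] zero_le_power2[of p0]
      unfolding n_def by linarith+
    with False show False by simp
  qed
  define K where "K = k / n"
  have "k = K * (9 * p3\<^sup>2 + p2\<^sup>2 + p1\<^sup>2 + 9 * p0\<^sup>2)"
    using n by (simp add: K_def flip: n_def)
  then have "k - 0 * (- K * p2)\<^sup>2 - 3 * p3 * (3 * K * p3) + p2 * (- K * p2)
      + 0 * (3 * (- 3 * K * p0) * (- K * p2) - (K * p1)\<^sup>2)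
      - K * p1 * (p1 - 0 * (- K * p2) - 3 * 0 * (3 * K * p3)) + 3 * (- 3 * K * p0) * (p0 - 3 * 0 * (3 * K * p3)) = 0"
    by algebra
  then have "ad_H (3 * K * p3) (- K * p2) (K * p1) (- 3 * K * p0) (0, 0, 0, p3, p2, p1, p0, k) = (0, 0, 0, p3, p2, p1, p0, 0)"
    unfolding ad_H.simps prod.inject by simp
  then have "coeff_equiv (0, 0, 0, p3, p2, p1, p0, k) (0, 0, 0, p3, p2, p1, p0, 0)"
    using coeff_equiv_H by metis
  moreover have "normalizable (0, 0, 0, p3, p2, p1, p0, 0)"
  proof (cases "p3 = 0")
    case True
    with False show ?thesis
      using normalizable_nilradical_p3_0 by blast
  next
    case p3: False
    \<comment> \<open>Thus \<open>- \<delta>\<close> is a real root of the cubic, and the Moebius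
      map sending t to \<open>- 1 / (t + \<delta>)\<close> moves it to infinity.\<close>
    obtain \<delta> where \<delta>: "p3 * \<delta> ^ 3 + (- p2) * \<delta>\<^sup>2 + p1 * \<delta> + (- p0) = 0"
      using cubic_root_exists[OF p3] .
    obtain q2 q1 q0 where q: "coeff_equiv (0, 0, 0, p3, p2, p1, p0, 0) (0, 0, 0, 0, q2, q1, q0, 0)"
      by (rule that, rule coeff_equiv_cubicI[of 0 \<delta> "- 1" 1, OF _ _ refl refl refl]) (use \<delta> in simp_all)
    have "(q2, q1, q0) \<noteq> (0, 0, 0)"
    proof
      assume 0: "(q2, q1, q0) = (0, 0, 0)"
      have "coeff_equiv (0, 0, 0, 0, 0, 0, 0, 0) (0, 0, 0, p3, p2, p1, p0, 0)"
        using coeff_equiv_sym[OF q] 0 by (simp only: prod.inject)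
      then show False
        using p3 unfolding coeff_equiv_def ad_H.simps ad_M.simps scaleR_Pair prod.inject by simp
    qed
    then show ?thesis
      using normalizable_nilradical_p3_0 normalizable_equiv[OF q] by blast
  qed
  ultimately show ?thesis
    by (rule normalizable_equiv)
qed

lemma normalizable_if_neq_0:
  assumes "v \<noteq> 0"
  shows "normalizable v"
proof -
  obtain a b c p3 p2 p1 p0 k where v: "v = (a, b, c, p3, p2, p1, p0, k)"
    by (metis surj_pair)
  show ?thesis
  proof (cases "(a, b, c) = (0, 0, 0)")
    case True
    with assms have "(p3, p2, p1, p0, k) \<noteq> (0, 0, 0, 0, 0)"
      by (simp add: v zero_prod_def)
    with True show ?thesis
      using normalizable_nilradical[of p3 p2 p1 p0 k] by (simp only: v prod.inject not_False_eq_True)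
  next
    case False
    obtain s' where "sl2_reduces (a, b, c) s'" "s' \<in> {(1, 0, 0), (0, 1, 0), (1, 0, 1)}"
      using sl2_normal_form[OF False] .
    then obtain a' b' c' where red: "sl2_reduces (a, b, c) (a', b', c')"
      and s': "(a', b', c') = (1, 0, 0) \<or> (a', b', c') = (0, 1, 0) \<or> (a', b', c') = (1, 0, 1)"
      by (cases s') (simp only: insert_iff empty_iff simp_thms)
    obtain q' where q': "coeff_equiv v (a', b', c', q')"
      using red[unfolded sl2_reduces_def prod.case, THEN spec[of _ "(p3, p2, p1, p0, k)"]] unfolding v by (rule exE)
    have "normalizable (a', b', c', q')"
    proof -
      obtain q3 q2 q1 q0 k' where "q' = (q3, q2, q1, q0, k')" by (metis surj_pair)
      then show ?thesis
        using s' normalizable_parabolic[of q3 q2 q1 q0 k'] normalizable_hyperbolic[of q3 q2 q1 q0 k']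
          normalizable_elliptic[of q3 q2 q1 q0 k']
        by (elim disjE) (simp_all only: prod.inject simp_thms)
    qed
    then show ?thesis
      by (rule normalizable_equiv[OF q'])
  qed
qed

section \<open>Separating the representatives\<close>

fun disc :: "coeffs \<Rightarrow> real" where
  "disc (a, b, c, q) = b\<^sup>2 - a * c"

fun in_nilradical :: "coeffs \<Rightarrow> bool" where
  "in_nilradical (a, b, c, q) \<longleftrightarrow> (a, b, c) = (0, 0, 0)"

text \<open>\<open>disc\<close> is multiplied by the square of \<open>r\<close>, so its sign is
  invariant and isolates \<open>S3\<close> and \<open>S4\<close>. Vanishing of the quadratic form
  separates \<open>S5\<close> to \<open>S8\<close> from \<open>S1\<close> and
  \<open>S2\<close>.\<close>

lemma coeff_equiv_invariants:
  assumes "coeff_equiv v w"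
  shows "sgn (disc v) = sgn (disc w)" and "in_nilradical v \<Longrightarrow> in_nilradical w"
proof -
  obtain a b c p3 p2 p1 p0 k where v: "v = (a, b, c, p3, p2, p1, p0, k)" by (metis surj_pair)
  obtain a' b' c' q' where w: "w = (a', b', c', q')" by (metis surj_pair)
  obtain \<alpha> \<beta> \<gamma> \<delta> l0 l1 l2 l3 r where "\<alpha> * \<delta> - \<beta> * \<gamma> = 1" and r: "r \<noteq> 0"
    and "w = r *\<^sub>R ad_M \<alpha> \<beta> \<gamma> \<delta> (ad_H l0 l1 l2 l3 (a, b, c, p3, p2, p1, p0, k))"
    using assms unfolding coeff_equiv_def v by blast
  then have det: "(\<alpha> * \<delta> - \<beta> * \<gamma>)\<^sup>2 = 1"
    and e: "a' = r * (a * \<alpha>\<^sup>2 - 2 * b * \<alpha> * \<beta> + c * \<beta>\<^sup>2)"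
      "b' = r * (- a * \<alpha> * \<gamma> + b * (\<alpha> * \<delta> + \<beta> * \<gamma>) - c * \<beta> * \<delta>)"
      "c' = r * (a * \<gamma>\<^sup>2 - 2 * b * \<gamma> * \<delta> + c * \<delta>\<^sup>2)"
    unfolding w ad_H.simps ad_M.simps scaleR_Pair prod.inject real_scaleR_def by simp_all
  have "disc w = (\<alpha> * \<delta> - \<beta> * \<gamma>)\<^sup>2 * (r\<^sup>2 * disc v)"
    unfolding v w disc.simps e by algebra
  moreover have "sgn (r\<^sup>2) = 1"
    using r by (intro sgn_pos) simp
  ultimately show "sgn (disc v) = sgn (disc w)"
    unfolding det by (simp only: sgn_mult mult_1)
  show "in_nilradical v \<Longrightarrow> in_nilradical w"
    unfolding v w in_nilradical.simps e by simp
qed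

text \<open>Matrices preserve the zero cubic and fix the last entry. Undoing the matrix therefore
  shows that the shift alone already kills the cubic.\<close>

lemma coeff_equiv_nilradical_part_0:
  assumes "coeff_equiv (a, b, c, p3, p2, p1, p0, k) (a', b', c', 0, 0, 0, 0, k')"
  obtains \<alpha> \<beta> \<gamma> \<delta> l0 l1 l2 l3 r where "\<alpha> * \<delta> - \<beta> * \<gamma> = 1" "r \<noteq> 0"
    "a' = r * (a * \<alpha>\<^sup>2 - 2 * b * \<alpha> * \<beta> + c * \<beta>\<^sup>2)"
    "b' = r * (- a * \<alpha> * \<gamma> + b * (\<alpha> * \<delta> + \<beta> * \<gamma>) - c * \<beta> * \<delta>)"
    "c' = r * (a * \<gamma>\<^sup>2 - 2 * b * \<gamma> * \<delta> + c * \<delta>\<^sup>2)"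
    "ad_H l0 l1 l2 l3 (a, b, c, p3, p2, p1, p0, k) = (a, b, c, 0, 0, 0, 0, k' / r)"
proof -
  obtain \<alpha> \<beta> \<gamma> \<delta> l0 l1 l2 l3 r where det: "\<alpha> * \<delta> - \<beta> * \<gamma> = 1" and r: "r \<noteq> 0"
    and w: "(a', b', c', 0, 0, 0, 0, k') = r *\<^sub>R ad_M \<alpha> \<beta> \<gamma> \<delta> (ad_H l0 l1 l2 l3 (a, b, c, p3, p2, p1, p0, k))"
    using assms unfolding coeff_equiv_def by blast
  have e: "a' = r * (a * \<alpha>\<^sup>2 - 2 * b * \<alpha> * \<beta> + c * \<beta>\<^sup>2)"
      "b' = r * (- a * \<alpha> * \<gamma> + b * (\<alpha> * \<delta> + \<beta> * \<gamma>) - c * \<beta> * \<delta>)"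
      "c' = r * (a * \<gamma>\<^sup>2 - 2 * b * \<gamma> * \<delta> + c * \<delta>\<^sup>2)"
    using w unfolding ad_H.simps ad_M.simps scaleR_Pair prod.inject real_scaleR_def by simp_all
  have "ad_H l0 l1 l2 l3 (a, b, c, p3, p2, p1, p0, k)
      = ad_M \<delta> (- \<beta>) (- \<gamma>) \<alpha> ((1 / r) *\<^sub>R (a', b', c', 0, 0, 0, 0, k'))"
    using det r unfolding w ad_M_scaleR by (simp only: ad_M_ad_M) (simp add: mult.commute ad_M_id del: ad_H.simps)
  then obtain x y z where H: "ad_H l0 l1 l2 l3 (a, b, c, p3, p2, p1, p0, k) = (x, y, z, 0, 0, 0, 0, k' / r)"
    unfolding ad_M.simps scaleR_Pair by (simp del: ad_H.simps)
  then have "x = a" "y = b" "z = c"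
    by simp_all
  with H have "ad_H l0 l1 l2 l3 (a, b, c, p3, p2, p1, p0, k) = (a, b, c, 0, 0, 0, 0, k' / r)"
    by (simp only:)
  with that det r e show thesis by blast
qed

text \<open>With T = 0 a shift touches only the last entry, so the cubics are related by the matrix
  and \<open>r\<close> alone.\<close>

lemma coeff_equiv_nilradical:
  assumes "coeff_equiv (0, 0, 0, p3, p2, p1, p0, k) (a, b, c, q3, q2, q1, q0, k')"
  obtains \<alpha> \<beta> \<gamma> \<delta> r where "\<alpha> * \<delta> - \<beta> * \<gamma> = 1" "r \<noteq> 0"
    "q3 = r * (p3 * \<delta> ^ 3 - p2 * \<delta>\<^sup>2 * \<gamma> + p1 * \<delta> * \<gamma>\<^sup>2 - p0 * \<gamma> ^ 3)"
    "q2 = r * (- 3 * p3 * \<delta>\<^sup>2 * \<beta> + p2 * (\<delta>\<^sup>2 * \<alpha> + 2 * \<delta> * \<beta> * \<gamma>) - p1 * (\<beta> * \<gamma>\<^sup>2 + 2 * \<delta> * \<alpha> * \<gamma>) + 3 * p0 * \<alpha> * \<gamma>\<^sup>2)"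
    "q1 = r * (3 * p3 * \<delta> * \<beta>\<^sup>2 - p2 * (2 * \<delta> * \<beta> * \<alpha> + \<beta>\<^sup>2 * \<gamma>) + p1 * (\<delta> * \<alpha>\<^sup>2 + 2 * \<beta> * \<alpha> * \<gamma>) - 3 * p0 * \<alpha>\<^sup>2 * \<gamma>)"
    "q0 = r * (- p3 * \<beta> ^ 3 + p2 * \<beta>\<^sup>2 * \<alpha> - p1 * \<beta> * \<alpha>\<^sup>2 + p0 * \<alpha> ^ 3)"
proof -
  obtain \<alpha> \<beta> \<gamma> \<delta> l0 l1 l2 l3 r where det: "\<alpha> * \<delta> - \<beta> * \<gamma> = 1" and r: "r \<noteq> 0"
    and w: "(a, b, c, q3, q2, q1, q0, k') = r *\<^sub>R ad_M \<alpha> \<beta> \<gamma> \<delta> (ad_H l0 l1 l2 l3 (0, 0, 0, p3, p2, p1, p0, k))"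
    using assms unfolding coeff_equiv_def by blast
  show thesis
    by (rule that[OF det r])
      (use w in \<open>simp_all only: ad_H.simps ad_M.simps scaleR_Pair prod.inject real_scaleR_def mult_zero_left mult_zero_right
        add_0_right diff_0_right\<close>)
qed

text \<open>For T = 1 no shift changes the leading coefficient 1 of the cubic.\<close>

lemma S1_S2_inequivalent: "\<not> coeff_equiv (representative S1) (representative (S2 d))"
  unfolding representative.simps by (auto elim: coeff_equiv_nilradical_part_0)

text \<open>Keeping the zero cubic forces L to be constant, which does not move the last entry; so
  that entry changes only by \<open>r\<close>, and \<open>r * \<alpha>^2 = 1\<close> makes
  \<open>r\<close> positive.\<close>

lemma S2_unique:
  assumes "coeff_equiv (representative (S2 d)) (representative (S2 d'))"
  shows "sgn d = sgn d'"
proof -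
  obtain \<alpha> l0 l1 l2 l3 r :: real where r: "1 = r * \<alpha>\<^sup>2"
    and "ad_H l0 l1 l2 l3 (1, 0, 0, 0, 0, 0, 0, d) = (1, 0, 0, 0, 0, 0, 0, d' / r)"
    using assms unfolding representative.simps by (rule coeff_equiv_nilradical_part_0) simp
  then have "d = d' / r"
    by auto
  moreover have "r > 0"
    using r by (metis zero_less_mult_iff zero_less_one not_less zero_le_power2)
  ultimately show ?thesis by (simp add: sgn_mult sgn_divide)
qed

text \<open>Invertibility of the shift forces \<lambda> = 0, so only \<open>r\<close> acts on the
  parameter. Here \<open>r\<close> may be 1 or -1, and nonnegativity of both parameters settles the
  sign.\<close>

lemma S3_unique:
  assumes "coeff_equiv (representative (S3 d)) (representative (S3 d'))" "d \<ge> 0" "d' \<ge> 0"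
  shows "d = d'"
proof -
  obtain \<alpha> \<beta> \<gamma> \<delta> l0 l1 l2 l3 r :: real where r: "\<alpha> * \<delta> - \<beta> * \<gamma> = 1" "r \<noteq> 0" "0 = r * (- 2 * \<alpha> * \<beta>)"
    "1 = r * (\<alpha> * \<delta> + \<beta> * \<gamma>)" "0 = r * (- 2 * \<gamma> * \<delta>)"
    and "ad_H l0 l1 l2 l3 (0, 1, 0, 0, 0, 0, 0, d) = (0, 1, 0, 0, 0, 0, 0, d' / r)"
    using assms(1) unfolding representative.simps by (rule coeff_equiv_nilradical_part_0) simp
  then have "d = d' / r"
    by auto
  moreover have "r\<^sup>2 = 1"
    using r by algebra
  ultimately show ?thesis
    using assms(2,3) by (auto simp: power2_eq_1_iff)
qed

text \<open>As for \<open>S3\<close>, but definiteness of 1 + t^2 rules out \<open>r = -1\<close>,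
  so the sign of the parameter matters.\<close>

lemma S4_unique:
  assumes "coeff_equiv (representative (S4 d)) (representative (S4 d'))"
  shows "d = d'"
proof -
  obtain \<alpha> \<beta> \<gamma> \<delta> l0 l1 l2 l3 r :: real where r: "\<alpha> * \<delta> - \<beta> * \<gamma> = 1" "r \<noteq> 0" "1 = r * (\<alpha>\<^sup>2 + \<beta>\<^sup>2)"
    "0 = r * (- \<alpha> * \<gamma> - \<beta> * \<delta>)" "1 = r * (\<gamma>\<^sup>2 + \<delta>\<^sup>2)"
    and "ad_H l0 l1 l2 l3 (1, 0, 1, 0, 0, 0, 0, d) = (1, 0, 1, 0, 0, 0, 0, d' / r)"
    using assms(1) unfolding representative.simps by (rule coeff_equiv_nilradical_part_0) simp
  then have "d = d' / r"
    by auto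
  moreover have "r\<^sup>2 = 1"
    using r by algebra
  moreover have "r > 0"
    using r(3) by (metis zero_less_mult_iff zero_less_one not_less sum_power2_ge_zero)
  ultimately show ?thesis
    by (auto simp: power2_eq_1_iff)
qed

lemma S8_inequivalent:
  "\<not> coeff_equiv (representative S8) (representative S7)" "\<not> coeff_equiv (representative S8) (representative S6)" "\<not> coeff_equiv (representative S8) (representative (S5 e))"
  by (auto elim!: coeff_equiv_nilradical)

text \<open>The form of \<open>S7\<close> has a triple root at infinity. A vanishing leading
  coefficient of the image forces \<gamma> = 0, and then constants stay constant.\<close>

lemma S7_S6_inequivalent: "\<not> coeff_equiv (representative S7) (representative S6)"
  by (auto elim!: coeff_equiv_nilradical)

lemma S7_S5_inequivalent: "\<not> coeff_equiv (representative S7) (representative (S5 e))"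
  by (auto elim!: coeff_equiv_nilradical)

text \<open>A double root cannot split into distinct, possibly complex, roots. For
  \<open>e = 0\<close> the target itself has a double root and is equivalent to
  \<open>S6\<close>.\<close>

lemma S6_S5_inequivalent:
  assumes "e \<noteq> 0"
  shows "\<not> coeff_equiv (representative S6) (representative (S5 e))"
proof
  assume "coeff_equiv (representative S6) (representative (S5 e))"
  then obtain \<alpha> \<beta> \<gamma> \<delta> r :: real where r: "\<alpha> * \<delta> - \<beta> * \<gamma> = 1" "r \<noteq> 0" "0 = r * (\<delta> * \<gamma>\<^sup>2)"
    "1 = r * (- (\<beta> * \<gamma>\<^sup>2 + 2 * \<delta> * \<alpha> * \<gamma>))" "0 = r * (\<delta> * \<alpha>\<^sup>2 + 2 * \<beta> * \<alpha> * \<gamma>)" "e = r * (- \<beta> * \<alpha>\<^sup>2)"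
    unfolding representative.simps by (rule coeff_equiv_nilradical) simp
  then have "\<delta> * \<gamma> = 0" by simp
  with r have "\<delta> = 0" by auto
  with r have "\<alpha> = 0" by auto
  with r(6) assms show False by simp
qed

lemma S5_unique:
  assumes "coeff_equiv (representative (S5 e)) (representative (S5 e'))"
  shows "sgn e = sgn e'"
proof -
  obtain \<alpha> \<beta> \<gamma> \<delta> r :: real where r: "\<alpha> * \<delta> - \<beta> * \<gamma> = 1" "r \<noteq> 0"
    "0 = r * (- \<delta>\<^sup>2 * \<gamma> - e * \<gamma> ^ 3)"
    "1 = r * (\<delta>\<^sup>2 * \<alpha> + 2 * \<delta> * \<beta> * \<gamma> + 3 * e * \<alpha> * \<gamma>\<^sup>2)"
    "0 = r * (- (2 * \<delta> * \<beta> * \<alpha> + \<beta>\<^sup>2 * \<gamma>) - 3 * e * \<alpha>\<^sup>2 * \<gamma>)"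
    "e' = r * (\<beta>\<^sup>2 * \<alpha> + e * \<alpha> ^ 3)"
    using assms unfolding representative.simps by (rule coeff_equiv_nilradical) simp
  txt \<open>The discriminant of a binary cubic is an invariant; for the normal form it equals \<open>- 4 * e\<close>.\<close>
  let ?disc = "\<lambda>p3 p2 p1 p0::real. p1\<^sup>2 * p2\<^sup>2 - 4 * p0 * p2 ^ 3 - 4 * p1 ^ 3 * p3 + 18 * p0 * p1 * p2 * p3 - 27 * p0\<^sup>2 * p3\<^sup>2"
  have "?disc (r * (- \<delta>\<^sup>2 * \<gamma> - e * \<gamma> ^ 3)) (r * (\<delta>\<^sup>2 * \<alpha> + 2 * \<delta> * \<beta> * \<gamma> + 3 * e * \<alpha> * \<gamma>\<^sup>2))
    (r * (- (2 * \<delta> * \<beta> * \<alpha> + \<beta>\<^sup>2 * \<gamma>) - 3 * e * \<alpha>\<^sup>2 * \<gamma>)) (r * (\<beta>\<^sup>2 * \<alpha> + e * \<alpha> ^ 3))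
    = r ^ 4 * (\<alpha> * \<delta> - \<beta> * \<gamma>) ^ 6 * (- 4 * e)"
    by algebra
  then have "e' = r ^ 4 * e"
    unfolding r(3-6)[symmetric] r(1) by simp
  moreover have "sgn (r ^ 4) = 1"
    using r(2) by (intro sgn_pos) simp
  ultimately show ?thesis by (simp only: sgn_mult mult_1)
qed

lemma representative_unique:
  assumes "i \<in> admissible_labels" "j \<in> admissible_labels" "coeff_equiv (representative i) (representative j)"
  shows "i = j"
proof -
  have 2: "\<forall>d d'. i = S2 d \<and> j = S2 d' \<longrightarrow> d = d'"
  proof (intro allI impI)
    fix d d'
    assume *: "i = S2 d \<and> j = S2 d'"
    then have "sgn d = sgn d'" "d \<in> {-1, 0, 1}" "d' \<in> {-1, 0, 1}"
      using S2_unique[of d d'] assms by (simp_all only:) (auto simp: admissible_labels_def)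
    then show "d = d'" by auto
  qed
  have 3: "\<forall>d d'. i = S3 d \<and> j = S3 d' \<longrightarrow> d = d'"
  proof (intro allI impI)
    fix d d'
    assume *: "i = S3 d \<and> j = S3 d'"
    then have "d \<ge> 0" "d' \<ge> 0"
      using assms(1,2) by (auto simp: admissible_labels_def)
    with * show "d = d'"
      using S3_unique[of d d'] assms(3) by (simp only:)
  qed
  have 4: "\<forall>d d'. i = S4 d \<and> j = S4 d' \<longrightarrow> d = d'"
  proof (intro allI impI)
    fix d d'
    assume *: "i = S4 d \<and> j = S4 d'"
    then show "d = d'"
      using S4_unique[of d d'] assms(3) by (simp only:)
  qed
  have 5: "\<forall>d d'. i = S5 d \<and> j = S5 d' \<longrightarrow> d = d'"
  proof (intro allI impI)
    fix d d'
    assume *: "i = S5 d \<and> j = S5 d'"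
    then have "sgn d = sgn d'" "d \<in> {-1, 0, 1}" "d' \<in> {-1, 0, 1}"
      using S5_unique[of d d'] assms by (simp_all only:) (auto simp: admissible_labels_def)
    then show "d = d'" by auto
  qed
  \<comment> \<open>Stated for arbitrary labels because each inequivalence was proved in one
    direction only; it is applied to both orders of the pair.\<close>
  have distinct: "\<forall>e. \<not> (i = S1 \<and> j = S2 e) \<and> \<not> (i = S8 \<and> j = S5 e) \<and> \<not> (i = S7 \<and> j = S5 e) \<and> \<not> (i = S6 \<and> j = S5 e)"
    "\<not> (i = S8 \<and> j = S7)" "\<not> (i = S8 \<and> j = S6)" "\<not> (i = S7 \<and> j = S6)"
    if "coeff_equiv (representative i) (representative j)" "j \<in> admissible_labels" for i j
  proof -
    have "\<not> (i = S6 \<and> j = S5 e)" for e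
    proof (cases "e = 0")
      case True
      with that(2) show ?thesis by (auto simp: admissible_labels_def)
    next
      case False
      with that(1) show ?thesis using S6_S5_inequivalent by blast
    qed
    then show "\<forall>e. \<not> (i = S1 \<and> j = S2 e) \<and> \<not> (i = S8 \<and> j = S5 e) \<and> \<not> (i = S7 \<and> j = S5 e) \<and> \<not> (i = S6 \<and> j = S5 e)"
      using that(1) S1_S2_inequivalent S8_inequivalent(3) S7_S5_inequivalent by blast
    show "\<not> (i = S8 \<and> j = S7)" "\<not> (i = S8 \<and> j = S6)" "\<not> (i = S7 \<and> j = S6)"
      using that(1) S8_inequivalent(1,2) S7_S6_inequivalent by blast+
  qed
  have "sgn (disc (representative i)) = sgn (disc (representative j))" "in_nilradical (representative i) = in_nilradical (representative j)"
    using coeff_equiv_invariants[OF assms(3)] coeff_equiv_invariants[OF coeff_equiv_sym[OF assms(3)]] by blast+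
  moreover note distinct[OF assms(3,2)] distinct[OF coeff_equiv_sym[OF assms(3)] assms(1)] 2 3 4 5
  ultimately show ?thesis
    by (cases i; cases j; simp)
qed

theorem lemma4:
  shows "complete_list 1 admissible_labels listed_subalgebra"
  unfolding complete_list_def
proof (intro conjI ballI allI impI)
  fix i
  show "subalgebra (listed_subalgebra i)" "dim (listed_subalgebra i) = 1"
    unfolding listed_subalgebra_eq using subalgebra_span_vf dim_span_vf[OF representative_neq_0] by blast+
next
  fix S
  assume "subalgebra S \<and> dim S = 1"
  then obtain v where v: "v \<noteq> 0" "S = span {vf v}"
    using one_dim_subalgebra_cases by blast
  have iff: "G_equivalent S (listed_subalgebra i) \<longleftrightarrow> coeff_equiv v (representative i)" for i
    unfolding listed_subalgebra_eq v(2) by (rule G_equivalent_span_iff[OF representative_neq_0])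
  obtain i where i: "i \<in> admissible_labels" "coeff_equiv v (representative i)"
    using normalizable_if_neq_0[OF v(1)] unfolding normalizable_def by blast
  show "\<exists>!i. i \<in> admissible_labels \<and> G_equivalent S (listed_subalgebra i)"
    unfolding iff
  proof (rule ex1I)
    show "i \<in> admissible_labels \<and> coeff_equiv v (representative i)"
      using i by blast
  next
    fix j
    assume "j \<in> admissible_labels \<and> coeff_equiv v (representative j)"
    then show "j = i"
      using i representative_unique coeff_equiv_sym coeff_equiv_trans by blast
  qed
qed

end
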